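(* Let $(\mathfrak{M}, \tau)$ be a tracial von Neumann algebra, let $N \in \mathfrak{M}$ be a normal operator such that its spectrum is $\sigma(N) = \{\lambda_k\}^n_{k=1}$ (with $\lambda_1,\ldots,\lambda_n$ distinct), and let $w_k = \tau(1_{\{\lambda_k\}}(N))$ for each $k \in \{1,\ldots, n\}$. Then for each $\alpha \in (0,1]$, we have \[ V_\alpha(N) = \left\{ \frac{1}{\alpha} \sum^n_{k=1} \lambda_k t_k \ \middle|\ 0 \leq t_k \leq w_k,\ \sum^n_{k=1} t_k = \alpha\right\}. \]
   Context: A tracial von Neumann algebra is a pair $(\mathfrak{M},\tau)$ with $\mathfrak{M}$ a von Neumann algebra (unit $I_{\mathfrak{M}}$) and $\tau$ a normal, faithful, tracial state on $\mathfrak{M}$. For a normal operator $N$ and a Borel set $B\subseteq\mathbb{C}$, $1_B(N)$ is the spectral projection of $N$ for $B$. For $\alpha\in(0,1]$ and $T\in\mathfrak{M}$, the $\alpha$-numerical range of $T$ is $V_\alpha(T)=\frac1\alpha\{\tau(TX)\mid X\in\mathfrak{M},\ 0\le X\le I_{\mathfrak{M}},\ \tau(X)=\alpha\}$. *)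

theory Defs
  imports "HOL-Analysis.Analysis" "HOL-Library.Complex_Order"
begin

text \<open>
  Throughout, \<open>\<le>\<close> on complex numbers is the partial order of \<^theory>\<open>HOL-Library.Complex_Order\<close>:
  \<open>z \<le> w\<close> means that \<open>w - z\<close> is real and nonnegative.
\<close>

class scaleC =
  fixes scaleC :: "complex \<Rightarrow> 'a \<Rightarrow> 'a"  (infixr "*\<^sub>C" 75)

text \<open>Complex Hilbert spaces; the inner product is linear in its first argument.\<close>

class complex_hilbert_space = banach + scaleC +
  fixes cinner :: "'a \<Rightarrow> 'a \<Rightarrow> complex"
  assumes scaleC_add_right: "c *\<^sub>C (x + y) = c *\<^sub>C x + c *\<^sub>C y"
    and scaleC_add_left: "(c + d) *\<^sub>C x = c *\<^sub>C x + d *\<^sub>C x"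
    and scaleC_scaleC: "c *\<^sub>C d *\<^sub>C x = (c * d) *\<^sub>C x"
    and scaleR_scaleC: "r *\<^sub>R x = complex_of_real r *\<^sub>C x"
    and cinner_commute: "cinner x y = cnj (cinner y x)"
    and cinner_add_left: "cinner (x + y) z = cinner x z + cinner y z"
    and cinner_scaleC_left: "cinner (c *\<^sub>C x) y = c * cinner x y"
    and cinner_self_nonneg: "0 \<le> cinner x x"
    and norm_eq_sqrt_cinner: "norm x = sqrt (Re (cinner x x))"

lemma norm_scaleC: "norm (c *\<^sub>C x) = cmod c * norm (x :: 'h :: complex_hilbert_space)"
proof -
  have "cinner (c *\<^sub>C x) (c *\<^sub>C x) = c * cnj (cinner (c *\<^sub>C x) x)"
    using cinner_scaleC_left[of c x "c *\<^sub>C x"] cinner_commute[of x "c *\<^sub>C x"] by simp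
  also have "\<dots> = (c * cnj c) * cnj (cinner x x)"
    by (simp add: cinner_scaleC_left)
  also have "\<dots> = complex_of_real ((cmod c)\<^sup>2) * cinner x x"
    by (metis cinner_commute complex_norm_square)
  finally show ?thesis
    by (simp add: norm_eq_sqrt_cinner real_sqrt_mult)
qed

lemma bounded_linear_scaleC: "bounded_linear (\<lambda>x :: 'h :: complex_hilbert_space. c *\<^sub>C x)"
proof (rule bounded_linear_intro)
  show "c *\<^sub>C r *\<^sub>R x = r *\<^sub>R c *\<^sub>C x" for r and x :: 'h
    by (simp add: scaleR_scaleC scaleC_scaleC mult.commute)
  show "norm (c *\<^sub>C x) \<le> norm x * cmod c" for x :: 'h
    by (simp add: norm_scaleC mult.commute)
qed (rule scaleC_add_right)

instantiation blinfun :: (real_normed_vector, complex_hilbert_space) scaleC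
begin

lift_definition scaleC_blinfun :: "complex \<Rightarrow> ('a \<Rightarrow>\<^sub>L 'b) \<Rightarrow> 'a \<Rightarrow>\<^sub>L 'b"
  is "\<lambda>c A x. c *\<^sub>C A x"
  by (rule bounded_linear_compose[OF bounded_linear_scaleC])

instance ..

end

text \<open>
  The type \<open>'h \<Rightarrow>\<^sub>L 'h\<close> consists of the bounded \<^emph>\<open>real\<close>-linear operators; the algebra of bounded
  operators of the complex Hilbert space is the following subset of it.
\<close>

definition bounded_operators :: "('h :: complex_hilbert_space \<Rightarrow>\<^sub>L 'h) set" where
  "bounded_operators = {A :: 'h \<Rightarrow>\<^sub>L 'h. \<forall>c x. A (c *\<^sub>C x) = c *\<^sub>C A x}"

definition hilbert_adjoint ::
    "('h :: complex_hilbert_space \<Rightarrow>\<^sub>L 'h) \<Rightarrow> 'h \<Rightarrow>\<^sub>L 'h" where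
  "hilbert_adjoint A = (THE B :: 'h \<Rightarrow>\<^sub>L 'h. \<forall>x y. cinner (A x) y = cinner x (B y))"

definition normal_operator :: "('h :: complex_hilbert_space \<Rightarrow>\<^sub>L 'h) \<Rightarrow> bool" where
  "normal_operator A \<longleftrightarrow> A \<in> bounded_operators \<and>
     A o\<^sub>L hilbert_adjoint A = hilbert_adjoint A o\<^sub>L A"

definition is_projection :: "('h :: complex_hilbert_space \<Rightarrow>\<^sub>L 'h) \<Rightarrow> bool" where
  "is_projection P \<longleftrightarrow> P \<in> bounded_operators \<and> P o\<^sub>L P = P \<and> hilbert_adjoint P = P"

definition operator_le ::
    "('h :: complex_hilbert_space \<Rightarrow>\<^sub>L 'h) \<Rightarrow> ('h \<Rightarrow>\<^sub>L 'h) \<Rightarrow> bool"  (infix "\<preceq>" 50) where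
  "A \<preceq> B \<longleftrightarrow> (\<forall>x. 0 \<le> cinner ((B - A) x) x)"

definition op_spectrum :: "('h :: complex_hilbert_space \<Rightarrow>\<^sub>L 'h) \<Rightarrow> complex set" where
  "op_spectrum A = {z. \<not> (\<exists>B \<in> bounded_operators.
     (A - z *\<^sub>C id_blinfun) o\<^sub>L B = id_blinfun \<and> B o\<^sub>L (A - z *\<^sub>C id_blinfun) = id_blinfun)}"

definition projection_valued_measure ::
    "(complex set \<Rightarrow> ('h :: complex_hilbert_space \<Rightarrow>\<^sub>L 'h)) \<Rightarrow> bool" where
  "projection_valued_measure E \<longleftrightarrow>
     (\<forall>B \<in> sets borel. is_projection (E B)) \<and>
     E {} = 0 \<and> E UNIV = id_blinfun \<and>
     (\<forall>A \<in> sets borel. \<forall>B \<in> sets borel. E (A \<inter> B) = E A o\<^sub>L E B) \<and>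
     (\<forall>B :: nat \<Rightarrow> complex set. range B \<subseteq> sets borel \<longrightarrow> disjoint_family B \<longrightarrow>
        (\<forall>x. (\<lambda>i. E (B i) x) sums E (\<Union>i. B i) x))"

definition scalar_measure ::
    "(complex set \<Rightarrow> ('h :: complex_hilbert_space \<Rightarrow>\<^sub>L 'h)) \<Rightarrow> 'h \<Rightarrow> complex measure" where
  "scalar_measure E x = measure_of UNIV (sets borel) (\<lambda>B. ennreal (Re (cinner (E B x) x)))"

text \<open>
  \<open>N = \<integral> z dE(z)\<close>, understood weakly. By polarization it is enough to test against the positive
  measures \<open>B \<mapsto> \<langle>E(B) x, x\<rangle>\<close>.
\<close>

definition is_spectral_measure_of ::
    "(complex set \<Rightarrow> ('h :: complex_hilbert_space \<Rightarrow>\<^sub>L 'h)) \<Rightarrow> ('h \<Rightarrow>\<^sub>L 'h) \<Rightarrow> bool" where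
  "is_spectral_measure_of E N \<longleftrightarrow> projection_valued_measure E \<and>
     (\<forall>x. integrable (scalar_measure E x) (\<lambda>z. z) \<and>
          cinner (N x) x = (LINT z|scalar_measure E x. z))"

text \<open>
  The spectral projection \<open>1\<^sub>B(N)\<close> of a normal operator \<open>N\<close> for a Borel set \<open>B\<close>. The spectral
  measure \<open>E\<close> itself is unique only on Borel sets, so the description ranges over the value \<open>E B\<close>.
\<close>

definition spectral_projection ::
    "('h :: complex_hilbert_space \<Rightarrow>\<^sub>L 'h) \<Rightarrow> complex set \<Rightarrow> 'h \<Rightarrow>\<^sub>L 'h" where
  "spectral_projection N B = (THE P. \<exists>E. is_spectral_measure_of E N \<and> P = E B)"

definition von_neumann_algebra :: "('h :: complex_hilbert_space \<Rightarrow>\<^sub>L 'h) set \<Rightarrow> bool" where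
  "von_neumann_algebra M \<longleftrightarrow>
     M \<subseteq> bounded_operators \<and> id_blinfun \<in> M \<and>
     (\<forall>A \<in> M. \<forall>B \<in> M. A + B \<in> M \<and> A o\<^sub>L B \<in> M) \<and>
     (\<forall>c. \<forall>A \<in> M. c *\<^sub>C A \<in> M) \<and>
     (\<forall>A \<in> M. hilbert_adjoint A \<in> M) \<and>
     closedin strong_operator_topology M"

text \<open>Functionals on \<open>M\<close> are functions on all operators; only their values on \<open>M\<close> matter.\<close>

definition state_on ::
    "('h :: complex_hilbert_space \<Rightarrow>\<^sub>L 'h) set \<Rightarrow> (('h \<Rightarrow>\<^sub>L 'h) \<Rightarrow> complex) \<Rightarrow> bool" where
  "state_on M \<tau> \<longleftrightarrow>
     (\<forall>A \<in> M. \<forall>B \<in> M. \<tau> (A + B) = \<tau> A + \<tau> B) \<and>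
     (\<forall>c. \<forall>A \<in> M. \<tau> (c *\<^sub>C A) = c * \<tau> A) \<and>
     (\<forall>A \<in> M. 0 \<preceq> A \<longrightarrow> 0 \<le> \<tau> A) \<and>
     \<tau> id_blinfun = 1"

definition faithful_on ::
    "('h :: complex_hilbert_space \<Rightarrow>\<^sub>L 'h) set \<Rightarrow> (('h \<Rightarrow>\<^sub>L 'h) \<Rightarrow> complex) \<Rightarrow> bool" where
  "faithful_on M \<tau> \<longleftrightarrow> (\<forall>A \<in> M. 0 \<preceq> A \<longrightarrow> \<tau> A = 0 \<longrightarrow> A = 0)"

definition tracial_on ::
    "('h :: complex_hilbert_space \<Rightarrow>\<^sub>L 'h) set \<Rightarrow> (('h \<Rightarrow>\<^sub>L 'h) \<Rightarrow> complex) \<Rightarrow> bool" where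
  "tracial_on M \<tau> \<longleftrightarrow> (\<forall>A \<in> M. \<forall>B \<in> M. \<tau> (A o\<^sub>L B) = \<tau> (B o\<^sub>L A))"

text \<open>
  Normality: \<open>\<tau>\<close> preserves least upper bounds of upward directed sets of self-adjoint elements. As
  \<open>\<tau>\<close> is real and monotone there, it suffices that \<open>\<tau> S\<close> is below every upper bound of \<open>\<tau> ` D\<close>.
\<close>

definition normal_on ::
    "('h :: complex_hilbert_space \<Rightarrow>\<^sub>L 'h) set \<Rightarrow> (('h \<Rightarrow>\<^sub>L 'h) \<Rightarrow> complex) \<Rightarrow> bool" where
  "normal_on M \<tau> \<longleftrightarrow>
     (let Msa = {A \<in> M. hilbert_adjoint A = A} in
      \<forall>D S. D \<subseteq> Msa \<and> D \<noteq> {} \<and> (\<forall>A \<in> D. \<forall>B \<in> D. \<exists>C \<in> D. A \<preceq> C \<and> B \<preceq> C) \<and>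
            S \<in> Msa \<and> (\<forall>A \<in> D. A \<preceq> S) \<and> (\<forall>U \<in> Msa. (\<forall>A \<in> D. A \<preceq> U) \<longrightarrow> S \<preceq> U) \<longrightarrow>
            (\<forall>u. (\<forall>A \<in> D. \<tau> A \<le> u) \<longrightarrow> \<tau> S \<le> u))"

definition tracial_von_neumann_algebra ::
    "('h :: complex_hilbert_space \<Rightarrow>\<^sub>L 'h) set \<Rightarrow> (('h \<Rightarrow>\<^sub>L 'h) \<Rightarrow> complex) \<Rightarrow> bool" where
  "tracial_von_neumann_algebra M \<tau> \<longleftrightarrow>
     von_neumann_algebra M \<and> state_on M \<tau> \<and> normal_on M \<tau> \<and> faithful_on M \<tau> \<and> tracial_on M \<tau>"

definition alpha_numerical_range ::
    "('h :: complex_hilbert_space \<Rightarrow>\<^sub>L 'h) set \<Rightarrow> (('h \<Rightarrow>\<^sub>L 'h) \<Rightarrow> complex) \<Rightarrow> real \<Rightarrow> ('h \<Rightarrow>\<^sub>L 'h) \<Rightarrow>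
       complex set" where
  "alpha_numerical_range M \<tau> \<alpha> T =
     {complex_of_real (1 / \<alpha>) * \<tau> (T o\<^sub>L X) | X.
        X \<in> M \<and> 0 \<preceq> X \<and> X \<preceq> id_blinfun \<and> \<tau> X = complex_of_real \<alpha>}"

end

theory Submission
  imports Defs "HOL-Complex_Analysis.Complex_Analysis"
    "HOL-Computational_Algebra.Fundamental_Theorem_Algebra"
begin

text \<open>
  A normal operator \<open>N\<close> with finite spectrum is \<open>\<Sum>\<^sub>k \<lambda>\<^sub>k P\<^sub>k\<close>, where the \<open>P\<^sub>k\<close> are pairwise orthogonal
  projections with sum \<open>1\<close> and lie in \<open>M\<close>, being polynomials in \<open>N\<close>. Moreover \<open>P\<^sub>k\<close> is the spectral
  projection \<open>1\<^bsub>{\<lambda>\<^sub>k}\<^esub>(N)\<close>. If \<open>0 \<le> X \<le> 1\<close>, then \<open>\<tau>(N X) = \<Sum>\<^sub>k \<lambda>\<^sub>k \<tau>(P\<^sub>k X)\<close>, and \<open>t\<^sub>k = \<tau>(P\<^sub>k X) = \<tau>(P\<^sub>k X P\<^sub>k)\<close>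
  lies between \<open>0\<close> and \<open>w\<^sub>k = \<tau>(P\<^sub>k)\<close> because \<open>0 \<le> P\<^sub>k X P\<^sub>k \<le> P\<^sub>k\<close> (\<open>trace_compression\<close>). Conversely, weights
  \<open>t\<^sub>k\<close> are realised by \<open>X = \<Sum>\<^sub>k (t\<^sub>k / w\<^sub>k) P\<^sub>k\<close>.

  The work lies in the spectral theory behind the first two sentences.

  \<^item> A polynomial that vanishes on the spectrum of \<open>N\<close> annihilates \<open>N\<close>
    (\<open>poly_op_eq_0_if_vanishes_on_spectrum\<close>). Factoring \<open>1 - z q\<close> into linear factors shows that
    \<open>1 - z q(N)\<close> is invertible for all \<open>z\<close>, and a normal operator \<open>T\<close> with this property is zero
    (\<open>normal_quasinilpotent_eq_0\<close>): the entire functions \<open>\<langle>(1 - z T)\<^sup>-\<^sup>1 x, y\<rangle>\<close> force \<open>\<parallel>T\<^sup>n x\<parallel>\<close> to decay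
    faster than any geometric sequence, whereas for normal \<open>T\<close> these norms are log-convex in \<open>n\<close>.

  \<^item> Consequently identities between polynomials in \<open>N\<close> are identities between functions on the
    spectrum. With \<open>P\<^sub>k\<close> the Lagrange interpolation polynomial of the indicator of \<open>\<lambda>\<^sub>k\<close>, all the
    algebraic relations above are immediate, and \<open>B \<mapsto> \<Sum> {P\<^sub>k | \<lambda>\<^sub>k \<in> B}\<close> is a spectral measure of \<open>N\<close>.

  \<^item> Every spectral measure \<open>E\<close> of \<open>N\<close> takes the value \<open>P\<^sub>k\<close> at \<open>{\<lambda>\<^sub>k}\<close>
    (\<open>spectral_projection_eq_spectral_part\<close>). For an eigenvector \<open>u\<close> with eigenvalue \<open>a\<close> the measure
    \<open>\<langle>E(\<cdot>) u, u\<rangle>\<close> has barycentre \<open>a\<close>; since \<open>E\<close> commutes with \<open>N\<close>, the same holds for the part of \<open>u\<close> in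
    an open half-plane bounded by a line through \<open>a\<close>, and that part must vanish. Four half-planes
    cover the complement of \<open>a\<close>, whence \<open>E({a}) u = u\<close>.
\<close>

section \<open>Complex inner products\<close>

lemma scaleC_one [simp]: "1 *\<^sub>C x = (x :: 'h :: complex_hilbert_space)"
  by (metis of_real_1 scaleR_one scaleR_scaleC)

lemma scaleC_zero_left [simp]: "0 *\<^sub>C x = (0 :: 'h :: complex_hilbert_space)"
  by (metis of_real_0 scaleR_zero_left scaleR_scaleC)

lemma scaleC_minus_one: "(-1) *\<^sub>C x = - (x :: 'h :: complex_hilbert_space)"
  by (metis of_real_1 of_real_minus scaleR_minus1_left scaleR_scaleC)

lemma scaleC_minus_left: "(- c) *\<^sub>C x = - (c *\<^sub>C x :: 'h :: complex_hilbert_space)"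
  by (metis scaleC_minus_one scaleC_scaleC mult_minus1)

lemma scaleC_diff_left: "(c - d) *\<^sub>C x = c *\<^sub>C x - (d *\<^sub>C x :: 'h :: complex_hilbert_space)"
  by (metis diff_conv_add_uminus scaleC_add_left scaleC_minus_left)

lemmas scaleC_zero_right [simp] = linear_0[OF bounded_linear.linear[OF bounded_linear_scaleC]]
lemmas scaleC_diff_right = linear_diff[OF bounded_linear.linear[OF bounded_linear_scaleC]]

lemma cinner_zero_left [simp]: "cinner 0 (y :: 'h :: complex_hilbert_space) = 0"
  using cinner_scaleC_left[of 0 0 y] by simp

lemma cinner_add_right:
  "cinner (x :: 'h :: complex_hilbert_space) (y + z) = cinner x y + cinner x z"
  by (metis cinner_commute cinner_add_left complex_cnj_add)

lemma cinner_scaleC_right: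
  "cinner (x :: 'h :: complex_hilbert_space) (c *\<^sub>C y) = cnj c * cinner x y"
  by (metis cinner_commute cinner_scaleC_left complex_cnj_mult)

lemma cinner_minus_left: "cinner (- x) (y :: 'h :: complex_hilbert_space) = - cinner x y"
  by (metis cinner_scaleC_left mult_minus1 scaleC_minus_one)

lemma cinner_minus_right: "cinner x (- y :: 'h :: complex_hilbert_space) = - cinner x y"
  by (metis cinner_commute cinner_minus_left complex_cnj_minus)

lemma cinner_diff_left:
  "cinner (x - y) (z :: 'h :: complex_hilbert_space) = cinner x z - cinner y z"
  by (metis cinner_add_left cinner_minus_left diff_conv_add_uminus)

lemma cinner_diff_right:
  "cinner (x :: 'h :: complex_hilbert_space) (y - z) = cinner x y - cinner x z"
  by (metis cinner_add_right cinner_minus_right diff_conv_add_uminus)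

lemma cinner_zero_right [simp]: "cinner (y :: 'h :: complex_hilbert_space) 0 = 0"
  by (metis cinner_commute cinner_zero_left complex_cnj_zero)

lemma cinner_scaleR_left:
  "cinner (r *\<^sub>R x) (y :: 'h :: complex_hilbert_space) = of_real r * cinner x y"
  by (simp add: scaleR_scaleC cinner_scaleC_left)

lemma cinner_scaleR_right:
  "cinner (x :: 'h :: complex_hilbert_space) (r *\<^sub>R y) = of_real r * cinner x y"
  by (simp add: scaleR_scaleC cinner_scaleC_right)

lemma cinner_sum_left:
  "cinner (\<Sum>i\<in>I. f i) (y :: 'h :: complex_hilbert_space) = (\<Sum>i\<in>I. cinner (f i) y)"
  by (induction I rule: infinite_finite_induct) (auto simp: cinner_add_left)

lemmas cinner_simps = cinner_add_left cinner_add_right cinner_diff_left cinner_diff_right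
  cinner_scaleC_left cinner_scaleC_right cinner_scaleR_left cinner_scaleR_right
  cinner_minus_left cinner_minus_right

lemma cinner_self: "cinner x x = of_real ((norm (x :: 'h :: complex_hilbert_space))\<^sup>2)"
  using cinner_self_nonneg[of x] norm_eq_sqrt_cinner[of x]
  by (simp add: complex_eq_iff less_eq_complex_def)

lemma Re_cinner_commute:
  "Re (cinner y x) = Re (cinner x (y :: 'h :: complex_hilbert_space))"
  by (metis cinner_commute complex_cnj_cnj cnj.simps(1))

lemma norm_add_squared:
  "(norm (x + y :: 'h :: complex_hilbert_space))\<^sup>2 = (norm x)\<^sup>2 + 2 * Re (cinner x y) + (norm y)\<^sup>2"
proof -
  have "Re (cinner (x + y) (x + y)) = (norm x)\<^sup>2 + 2 * Re (cinner x y) + (norm y)\<^sup>2"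
    by (simp only: cinner_add_left cinner_add_right plus_complex.sel cinner_self[of x]
        cinner_self[of y] Re_cinner_commute[of y x] Re_complex_of_real)
  then show ?thesis by (simp only: cinner_self Re_complex_of_real)
qed

text \<open>
  Cauchy--Schwarz: subtract from \<open>x\<close> its component along \<open>y\<close>; the remainder has a nonnegative
  squared norm.
\<close>

lemma cinner_Cauchy_Schwarz:
  "cmod (cinner x y) \<le> norm x * norm (y :: 'h :: complex_hilbert_space)"
proof (cases "y = 0")
  case False
  define c where "c = cinner x y / of_real ((norm y)\<^sup>2)"
  have y: "(norm y)\<^sup>2 > 0" using False by simp
  have "cinner (x - c *\<^sub>C y) (x - c *\<^sub>C y)
      = cinner x x - cnj c * cinner x y - c * cnj (cinner x y) + c * cnj c * cinner y y"
    using cinner_commute[of y x] by (simp add: cinner_simps algebra_simps)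
  also have "c * cnj c * cinner y y = c * cnj (cinner x y)"
    using y by (simp add: c_def cinner_self power2_eq_square)
  also have "cnj c * cinner x y = of_real ((cmod (cinner x y))\<^sup>2 / (norm y)\<^sup>2)"
    by (simp add: c_def complex_norm_square mult.commute del: of_real_power)
  finally have "(norm (x - c *\<^sub>C y))\<^sup>2 = (norm x)\<^sup>2 - (cmod (cinner x y))\<^sup>2 / (norm y)\<^sup>2"
    by (simp add: cinner_self flip: of_real_power of_real_diff of_real_divide)
  then have "(cmod (cinner x y))\<^sup>2 / (norm y)\<^sup>2 \<le> (norm x)\<^sup>2"
    by (metis diff_ge_0_iff_ge zero_le_power2)
  then have "(cmod (cinner x y))\<^sup>2 \<le> (norm x * norm y)\<^sup>2"
    using y by (simp add: field_simps power_mult_distrib)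
  then show ?thesis by (rule power2_le_imp_le) simp
qed simp

lemma bounded_linear_cinner_left:
  "bounded_linear (\<lambda>x. cinner x (y :: 'h :: complex_hilbert_space))"
  by (rule bounded_linear_intro[where K = "norm y"])
     (auto simp: cinner_simps scaleR_conv_of_real cinner_Cauchy_Schwarz)

lemma cinner_ext_right:
  assumes "\<And>x. cinner x y = cinner x (z :: 'h :: complex_hilbert_space)"
  shows "y = z"
  using assms[of "y - z"] cinner_self[of "y - z"] by (simp add: cinner_diff_right)

section \<open>Riesz representation and adjoints\<close>

lemma norm_squared_add_diff:
  "(norm (x + y))\<^sup>2 + (norm (x - y))\<^sup>2
     = 2 * (norm x)\<^sup>2 + 2 * (norm (y :: 'h :: complex_hilbert_space))\<^sup>2"
  using norm_add_squared[of x y] norm_add_squared[of x "- y"] by (simp add: cinner_minus_right)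

text \<open>
  The representing vector is the minimiser of \<open>F x = \<parallel>x\<parallel>\<^sup>2 - 2 Re (\<phi> x)\<close>. By the parallelogram law
  \<open>F\<close> is so strongly convex that every minimising sequence is Cauchy; that the derivative of \<open>F\<close>
  vanishes at the minimiser is the claim.
\<close>

lemma Riesz_representation:
  fixes \<phi> :: "'h :: complex_hilbert_space \<Rightarrow> complex"
  assumes bl: "bounded_linear \<phi>" and sc: "\<And>c x. \<phi> (c *\<^sub>C x) = c * \<phi> x"
  shows "\<exists>u. \<forall>x. \<phi> x = cinner x u"
proof -
  interpret bounded_linear \<phi> by fact
  define F where "F x = (norm x)\<^sup>2 - 2 * Re (\<phi> x)" for x
  obtain K where K: "\<And>x. cmod (\<phi> x) \<le> norm x * K" using bounded by blast
  have "- (K\<^sup>2) \<le> F x" for x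
  proof -
    have "Re (\<phi> x) \<le> norm x * K" using K[of x] complex_Re_le_cmod[of "\<phi> x"] by linarith
    moreover have "0 \<le> (norm x - K)\<^sup>2" by simp
    ultimately show ?thesis by (simp add: F_def power2_diff)
  qed
  then have bdd: "bdd_below (range F)" by (auto intro!: bdd_belowI)
  define m where "m = Inf (range F)"
  have m: "m \<le> F x" for x unfolding m_def by (rule cInf_lower[OF _ bdd]) simp
  have "\<exists>x. F x < m + 1 / real (Suc n)" for n
    using cInf_lessD[of "range F" "m + 1 / real (Suc n)"] by (auto simp: m_def)
  then obtain X where X: "\<And>n. F (X n) < m + 1 / real (Suc n)" by metis
  have mid: "(norm (x - y))\<^sup>2 \<le> 2 * (F x - m) + 2 * (F y - m)" for x y
  proof -
    have "(norm (x + y))\<^sup>2 = 4 * (norm ((1/2) *\<^sub>R (x + y)))\<^sup>2"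
      by (simp only: norm_scaleR power_mult_distrib) (simp add: power2_eq_square)
    moreover have "Re (\<phi> ((1/2) *\<^sub>R (x + y))) = (Re (\<phi> x) + Re (\<phi> y)) / 2"
      by (simp add: scaleR add)
    ultimately have "4 * F ((1/2) *\<^sub>R (x + y)) = (norm (x + y))\<^sup>2 - 4 * (Re (\<phi> x) + Re (\<phi> y))"
      by (simp add: F_def)
    then show ?thesis
      using m[of "(1/2) *\<^sub>R (x + y)"] norm_squared_add_diff[of x y] by (simp add: F_def)
  qed
  have "Cauchy X"
  proof (rule metric_CauchyI)
    fix e :: real assume e: "e > 0"
    then obtain n0 where n0: "inverse (real (Suc n0)) < e\<^sup>2 / 4"
      using reals_Archimedean[of "e\<^sup>2 / 4"] by auto
    have small: "1 / real (Suc k) < e\<^sup>2 / 4" if "k \<ge> n0" for k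
      by (rule le_less_trans[OF _ n0]) (use that in \<open>simp add: inverse_eq_divide frac_le\<close>)
    show "\<exists>M. \<forall>i\<ge>M. \<forall>j\<ge>M. dist (X i) (X j) < e"
    proof (intro exI allI impI)
      fix i j assume "i \<ge> n0" "j \<ge> n0"
      then have "1 / real (Suc i) < e\<^sup>2 / 4" "1 / real (Suc j) < e\<^sup>2 / 4"
        using small by blast+
      then have "F (X i) - m < e\<^sup>2 / 4" "F (X j) - m < e\<^sup>2 / 4"
        using X[of i] X[of j] by auto
      then have "(norm (X i - X j))\<^sup>2 < e\<^sup>2"
        using mid[of "X i" "X j"] by argo
      then show "dist (X i) (X j) < e"
        using e by (simp add: dist_norm power_less_imp_less_base)
    qed
  qed
  then obtain u where u: "X \<longlonglongrightarrow> u" by (auto simp: Cauchy_convergent_iff convergent_def)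
  have "(\<lambda>n. F (X n)) \<longlonglongrightarrow> F u" unfolding F_def by (intro tendsto_intros tendsto u)
  moreover have "(\<lambda>n. m + 1 / real (Suc n)) \<longlonglongrightarrow> m + 0"
    using LIMSEQ_inverse_real_of_nat by (intro tendsto_intros) (simp add: inverse_eq_divide)
  ultimately have "F u \<le> m + 0" using X by (intro LIMSEQ_le) (auto intro: less_imp_le)
  then have min: "F u \<le> F x" for x using m[of x] by linarith
  have real_part: "Re (\<phi> h) = Re (cinner h u)" for h
  proof -
    define d where "d = Re (cinner u h) - Re (\<phi> h)"
    have quad: "0 \<le> 2 * t * d + t\<^sup>2 * (norm h)\<^sup>2" for t
      using min[of "u + t *\<^sub>R h"] norm_add_squared[of u "t *\<^sub>R h"]
      by (simp add: F_def d_def add scaleR cinner_scaleR_right power_mult_distrib algebra_simps)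
    \<comment> \<open>The quadratic is nonnegative, so it has no linear term: \<open>t = - d / s\<close> nearly minimises it, the
      summand \<open>1\<close> only keeps \<open>s\<close> positive when \<open>h = 0\<close>.\<close>
    define s where "s = (norm h)\<^sup>2 + 1"
    have s: "s > 0" by (simp add: s_def add_nonneg_pos)
    have "0 \<le> 2 * (- d / s) * d + (- d / s)\<^sup>2 * s"
      using quad[of "- d / s"] by (simp add: s_def algebra_simps)
        (smt (verit) zero_le_power2 divide_nonneg_nonneg)
    also have "\<dots> = - (d\<^sup>2 / s)" using s by (simp add: power2_eq_square)
    finally have "d\<^sup>2 / s \<le> 0" by simp
    then have "d = 0" using s by (simp add: divide_le_0_iff not_less)
    then show ?thesis by (simp add: d_def Re_cinner_commute)
  qed
  have "\<phi> h = cinner h u" for h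
  proof (rule complex_eqI)
    show "Im (\<phi> h) = Im (cinner h u)"
      using real_part[of "\<i> *\<^sub>C h"] by (simp add: sc cinner_scaleC_left)
  qed (rule real_part)
  then show ?thesis by blast
qed

lemma scaleC_blinfun_apply [simp]: "blinfun_apply (c *\<^sub>C A) x = c *\<^sub>C blinfun_apply A x"
  by (simp add: scaleC_blinfun.rep_eq)

lemma bounded_operatorsD: "A \<in> bounded_operators \<Longrightarrow> blinfun_apply A (c *\<^sub>C x) = c *\<^sub>C blinfun_apply A x"
  by (simp add: bounded_operators_def)

lemma adjoint_exists:
  fixes A :: "'h :: complex_hilbert_space \<Rightarrow>\<^sub>L 'h"
  assumes A: "A \<in> bounded_operators"
  shows "\<exists>B \<in> bounded_operators. \<forall>x y. cinner (A x) y = cinner x (B y)"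
proof -
  have "\<exists>u. \<forall>x. cinner (A x) y = cinner x u" for y
    by (rule Riesz_representation)
       (auto simp: bounded_operatorsD[OF A] cinner_scaleC_left
          intro!: bounded_linear_compose[OF bounded_linear_cinner_left] blinfun.bounded_linear_right)
  then obtain b where b: "\<And>x y. cinner (A x) y = cinner x (b y)" by metis
  have bl: "bounded_linear b"
  proof (rule bounded_linear_intro)
    show "b (x + y) = b x + b y" for x y
      by (rule cinner_ext_right) (simp add: cinner_add_right flip: b)
    show "b (r *\<^sub>R x) = r *\<^sub>R b x" for r x
      by (rule cinner_ext_right) (simp add: cinner_scaleR_right flip: b)
    show "norm (b x) \<le> norm x * norm A" for x
    proof (cases "b x = 0")
      case False
      have "(norm (b x))\<^sup>2 = cmod (cinner (b x) (b x))" by (simp add: cinner_self norm_power)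
      also have "\<dots> = cmod (cinner (A (b x)) x)" by (simp add: b)
      also have "\<dots> \<le> norm (A (b x)) * norm x" by (rule cinner_Cauchy_Schwarz)
      also have "\<dots> \<le> norm A * norm (b x) * norm x"
        by (intro mult_right_mono norm_blinfun) simp
      finally show ?thesis using False by (simp add: power2_eq_square algebra_simps)
    qed simp
  qed
  show ?thesis
  proof (intro bexI[of _ "Blinfun b"] allI)
    show "cinner (A x) y = cinner x (Blinfun b y)" for x y
      by (simp add: bounded_linear_Blinfun_apply[OF bl] b)
    have "b (c *\<^sub>C x) = c *\<^sub>C b x" for c x
      by (rule cinner_ext_right) (simp add: cinner_scaleC_right flip: b)
    then show "Blinfun b \<in> bounded_operators"
      by (simp add: bounded_operators_def bounded_linear_Blinfun_apply[OF bl])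
  qed
qed

lemma hilbert_adjoint_eqI:
  assumes "\<And>x y. cinner (blinfun_apply A x) y = cinner x (blinfun_apply B y)"
  shows "hilbert_adjoint A = B"
  unfolding hilbert_adjoint_def
proof (rule the_equality)
  fix C :: "'a \<Rightarrow>\<^sub>L 'a" assume "\<forall>x y. cinner (A x) y = cinner x (C y)"
  then show "C = B" by (intro blinfun_eqI cinner_ext_right) (simp flip: assms)
qed (use assms in blast)

lemma
  assumes "A \<in> bounded_operators"
  shows cinner_adjoint: "cinner (blinfun_apply A x) y = cinner x (hilbert_adjoint A y)"
    and bounded_operators_adjoint: "hilbert_adjoint A \<in> bounded_operators"
proof -
  obtain B where "B \<in> bounded_operators" and B: "\<And>x y. cinner (A x) y = cinner x (B y)"
    using adjoint_exists[OF assms] by blast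
  moreover have "hilbert_adjoint A = B" by (rule hilbert_adjoint_eqI) (rule B)
  ultimately show "cinner (blinfun_apply A x) y = cinner x (hilbert_adjoint A y)"
    and "hilbert_adjoint A \<in> bounded_operators" by auto
qed

lemma cinner_adjoint':
  assumes "A \<in> bounded_operators"
  shows "cinner (hilbert_adjoint A x) y = cinner x (blinfun_apply A y)"
  by (metis assms cinner_adjoint cinner_commute)

lemma bounded_operators_closed:
  fixes A B :: "'h :: complex_hilbert_space \<Rightarrow>\<^sub>L 'h"
  shows "0 \<in> (bounded_operators :: ('h \<Rightarrow>\<^sub>L 'h) set)"
    and "id_blinfun \<in> (bounded_operators :: ('h \<Rightarrow>\<^sub>L 'h) set)"
    and "A \<in> bounded_operators \<Longrightarrow> c *\<^sub>C A \<in> bounded_operators"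
    and "A \<in> bounded_operators \<Longrightarrow> B \<in> bounded_operators \<Longrightarrow> A + B \<in> bounded_operators"
    and "A \<in> bounded_operators \<Longrightarrow> B \<in> bounded_operators \<Longrightarrow> A - B \<in> bounded_operators"
    and "A \<in> bounded_operators \<Longrightarrow> B \<in> bounded_operators \<Longrightarrow> A o\<^sub>L B \<in> bounded_operators"
  by (auto simp: bounded_operators_def blinfun.add_left blinfun.diff_left scaleC_add_right
      scaleC_diff_right scaleC_scaleC mult.commute)

text \<open>
  Polarization: testing \<open>x + y\<close> and \<open>x + \<i> y\<close> separates the two mixed terms of the form. Over the
  reals a rotation by a right angle would be a counterexample.
\<close>

lemma operator_eq_0_if_form_eq_0:
  fixes A :: "'h :: complex_hilbert_space \<Rightarrow>\<^sub>L 'h"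
  assumes A: "A \<in> bounded_operators" and form: "\<And>x. cinner (A x) x = 0"
  shows "A = 0"
proof (rule blinfun_eqI)
  fix x
  have *: "cinner (A x) y + cinner (A y) x = 0" for y
    using form[of "x + y"] by (simp add: blinfun.add_right cinner_simps form add.commute)
  have "cinner (A x) y = 0" for y
    using *[of y] *[of "\<i> *\<^sub>C y"]
    by (simp add: bounded_operatorsD[OF A] cinner_simps eq_neg_iff_add_eq_0[symmetric]
        flip: right_diff_distrib)
  from this[of "A x"] show "A x = blinfun_apply 0 x" by (simp add: cinner_self)
qed

section \<open>Normal quasinilpotent operators\<close>

lemma norm_adjoint_eq_if_normal:
  assumes "normal_operator T"
  shows "norm (hilbert_adjoint T x) = norm (blinfun_apply T x)"
proof -
  have T: "T \<in> bounded_operators" and comm: "T (hilbert_adjoint T x) = hilbert_adjoint T (T x)"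
    using assms by (auto simp: normal_operator_def dest: arg_cong[where f = "\<lambda>A. blinfun_apply A x"])
  have "cinner (hilbert_adjoint T x) (hilbert_adjoint T x) = cinner (T x) (T x)"
    by (metis T cinner_adjoint cinner_adjoint' comm)
  then have "(norm (hilbert_adjoint T x))\<^sup>2 = (norm (T x))\<^sup>2"
    by (simp only: cinner_self of_real_eq_iff)
  then show ?thesis by simp
qed

text \<open>
  Cauchy--Schwarz for \<open>\<langle>T x, T x\<rangle> = \<langle>T\<^sup>* T x, x\<rangle>\<close>, where \<open>T\<^sup>* T x\<close> has the same norm as \<open>T T x\<close> by
  normality. Along an orbit this is log-convexity of \<open>n \<mapsto> \<parallel>T\<^sup>n x\<parallel>\<close>: the ratios of successive norms
  do not decrease.
\<close>

lemma normal_log_convex: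
  assumes "normal_operator T"
  shows "(norm (blinfun_apply T x))\<^sup>2 \<le> norm (T (T x)) * norm x"
proof -
  have T: "T \<in> bounded_operators" using assms by (simp add: normal_operator_def)
  have "(norm (T x))\<^sup>2 = cmod (cinner (T x) (T x))" by (simp add: cinner_self norm_power)
  also have "\<dots> = cmod (cinner (hilbert_adjoint T (T x)) x)" by (simp add: cinner_adjoint'[OF T])
  also have "\<dots> \<le> norm (hilbert_adjoint T (T x)) * norm x" by (rule cinner_Cauchy_Schwarz)
  finally show ?thesis by (simp add: norm_adjoint_eq_if_normal[OF assms])
qed

lemma normal_power_lower_bound:
  assumes "normal_operator T"
  shows "(norm (blinfun_apply T x) / norm x) ^ n * norm x \<le> norm ((blinfun_apply T ^^ n) x)"
proof (cases "T x = 0 \<or> x = 0")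
  case True
  then show ?thesis by (cases n) auto
next
  case False
  define c where "c = norm (T x) / norm x"
  have c: "c > 0" using False by (simp add: c_def)
  have step: "(blinfun_apply T ^^ n) x \<noteq> 0 \<and>
      c * norm ((blinfun_apply T ^^ n) x) \<le> norm (T ((blinfun_apply T ^^ n) x))" for n
  proof (induction n)
    case 0
    then show ?case using False by (simp add: c_def)
  next
    case (Suc n)
    let ?u = "(blinfun_apply T ^^ n) x"
    have u: "norm ?u > 0" and le: "c * norm ?u \<le> norm (T ?u)" using Suc by auto
    have "0 < c * norm ?u" using c u by simp
    then have pos: "norm (T ?u) > 0" using le by linarith
    have "c * norm ?u * norm (T ?u) \<le> norm (T ?u) * norm (T ?u)"
      using le by (intro mult_right_mono) auto
    also have "\<dots> \<le> norm (T (T ?u)) * norm ?u"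
      using normal_log_convex[OF assms, of ?u] by (simp add: power2_eq_square)
    finally have "c * norm (T ?u) \<le> norm (T (T ?u))"
      using u by (simp add: mult.assoc mult.commute)
    then show ?case using pos by auto
  qed
  have "c ^ n * norm x \<le> norm ((blinfun_apply T ^^ n) x)"
  proof (induction n)
    case (Suc n)
    then have "c * (c ^ n * norm x) \<le> c * norm ((blinfun_apply T ^^ n) x)" using c by simp
    then show ?case using step[of n] by (simp add: mult.assoc)
  qed simp
  then show ?thesis by (simp add: c_def)
qed

text \<open>
  If \<open>1 - z T\<close> is always invertible, then \<open>z \<mapsto> \<langle>(1 - z T)\<^sup>-\<^sup>1 x, y\<rangle>\<close> is entire and its Taylor
  coefficients are \<open>\<langle>T\<^sup>n x, y\<rangle>\<close>, so by Cauchy's inequality \<open>\<parallel>T\<^sup>n x\<parallel> = O(R\<^sup>-\<^sup>n)\<close> for every \<open>R\<close>. The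
  geometric lower bound of a normal operator leaves only \<open>T x = 0\<close>.
\<close>

lemma normal_quasinilpotent_eq_0:
  fixes T :: "'h :: complex_hilbert_space \<Rightarrow>\<^sub>L 'h"
  assumes normal: "normal_operator T"
    and inv: "\<And>z. \<exists>S \<in> bounded_operators. S o\<^sub>L (id_blinfun - z *\<^sub>C T) = id_blinfun \<and>
                   (id_blinfun - z *\<^sub>C T) o\<^sub>L S = id_blinfun"
  shows "T = 0"
proof (rule blinfun_eqI)
  fix x :: 'h
  have T: "T \<in> bounded_operators" using normal by (simp add: normal_operator_def)
  obtain S where S: "\<And>z. S z \<in> bounded_operators"
    and SL: "\<And>z. S z o\<^sub>L (id_blinfun - z *\<^sub>C T) = id_blinfun"
    and SR: "\<And>z. (id_blinfun - z *\<^sub>C T) o\<^sub>L S z = id_blinfun"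
    using inv by metis
  have left: "S z (x - z *\<^sub>C T x) = x" and right: "S z x - z *\<^sub>C T (S z x) = x" for z x
    using arg_cong[OF SL[of z], of "\<lambda>A. blinfun_apply A x"]
      arg_cong[OF SR[of z], of "\<lambda>A. blinfun_apply A x"]
    by (simp_all add: blinfun.diff_left)
  have resolvent: "S z x - S u x = (z - u) *\<^sub>C S u (T (S z x))" for z u x
  proof -
    have "S z x - u *\<^sub>C T (S z x) = x + (z - u) *\<^sub>C T (S z x)"
      using right[of z x] by (simp add: scaleC_diff_left diff_eq_eq)
    then have "S u (S z x - u *\<^sub>C T (S z x)) = S u x + (z - u) *\<^sub>C S u (T (S z x))"
      by (simp add: blinfun.add_right bounded_operatorsD[OF S])
    then show ?thesis by (metis left add_diff_cancel_left')
  qed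
  \<comment> \<open>Near \<open>u\<close> the resolvent identity first bounds \<open>S z x\<close> by \<open>2 \<parallel>S u x\<parallel>\<close>, and then its distance
    from \<open>S u x\<close>.\<close>
  have cont: "((\<lambda>z. S z x) \<longlongrightarrow> S u x) (at u)" for u x
  proof (rule Lim_null[THEN iffD2], rule Lim_null_comparison)
    let ?K = "norm (S u o\<^sub>L T)"
    have "((\<lambda>z. cmod (z - u) * ?K) \<longlongrightarrow> cmod (u - u) * ?K) (at u)" by (intro tendsto_intros)
    then have "\<forall>\<^sub>F z in at u. cmod (z - u) * ?K < 1 / 2" by (rule order_tendstoD) simp
    then show "\<forall>\<^sub>F z in at u. norm (S z x - S u x) \<le> cmod (z - u) * ?K * (2 * norm (S u x))"
    proof eventually_elim
      case (elim z)
      have "norm (S z x - S u x) = cmod (z - u) * norm ((S u o\<^sub>L T) (S z x))"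
        by (simp add: resolvent norm_scaleC)
      also have "\<dots> \<le> cmod (z - u) * (?K * norm (S z x))"
        by (intro mult_left_mono norm_blinfun) simp
      finally have *: "norm (S z x - S u x) \<le> cmod (z - u) * ?K * norm (S z x)"
        by (simp add: mult.assoc)
      have "cmod (z - u) * ?K * norm (S z x) \<le> 1 / 2 * norm (S z x)"
        using elim by (intro mult_right_mono) auto
      moreover have "norm (S z x) \<le> norm (S u x) + norm (S z x - S u x)"
        using norm_triangle_ineq[of "S u x" "S z x - S u x"] by simp
      ultimately have "norm (S z x) \<le> 2 * norm (S u x)" using * by linarith
      then have "cmod (z - u) * ?K * norm (S z x) \<le> cmod (z - u) * ?K * (2 * norm (S u x))"
        by (intro mult_left_mono) auto
      with * show ?case by linarith
    qed
    have "((\<lambda>z. cmod (z - u) * ?K * (2 * norm (S u x))) \<longlongrightarrow> cmod (u - u) * ?K * (2 * norm (S u x))) (at u)"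
      by (intro tendsto_intros)
    then show "((\<lambda>z. cmod (z - u) * ?K * (2 * norm (S u x))) \<longlongrightarrow> 0) (at u)" by simp
  qed
  have holo: "(\<lambda>z. cinner (S z x) y) holomorphic_on UNIV" for x y
    unfolding holomorphic_on_open[OF open_UNIV]
  proof (intro ballI exI)
    fix u :: complex
    have "((\<lambda>z. cinner (S u (T (S z x))) y) \<longlongrightarrow> cinner (S u (T (S u x))) y) (at u)"
      by (intro bounded_linear.tendsto[OF bounded_linear_cinner_left]
          bounded_linear.tendsto[OF blinfun.bounded_linear_right] cont)
    then have "((\<lambda>z. (cinner (S z x) y - cinner (S u x) y) / (z - u))
        \<longlongrightarrow> cinner (S u (T (S u x))) y) (at u)"
      by (rule Lim_transform_eventually)
         (auto simp: eventually_at_filter resolvent cinner_scaleC_left simp flip: cinner_diff_left)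
    then show "((\<lambda>z. cinner (S z x) y) has_field_derivative cinner (S u (T (S u x))) y) (at u)"
      by (simp add: has_field_derivative_iff)
  qed
  \<comment> \<open>\<open>S z x = x + z S z (T x)\<close>, so passing from \<open>x\<close> to \<open>T x\<close> shifts the Taylor coefficients.\<close>
  have coeffs: "fps_nth (fps_expansion (\<lambda>z. cinner (S z x) y) 0) n
      = cinner ((blinfun_apply T ^^ n) x) y" for x y n
  proof (induction n arbitrary: x)
    case (Suc n)
    let ?F = "\<lambda>x. fps_expansion (\<lambda>z. cinner (S z x) y) 0"
    have exp: "(\<lambda>z. cinner (S z x) y) has_fps_expansion ?F x" for x
      by (rule has_fps_expansion_fps_expansion[OF open_UNIV _ holo]) simp
    have "cinner (S z x) y = cinner x y + z * cinner (S z (T x)) y" for z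
    proof -
      have "S z x = x + z *\<^sub>C S z (T x)"
        using left[of z x] by (simp add: blinfun.diff_right bounded_operatorsD[OF S] algebra_simps)
      then have "cinner (S z x) y = cinner (x + z *\<^sub>C S z (T x)) y" by simp
      then show ?thesis by (simp add: cinner_simps)
    qed
    moreover have "(\<lambda>z. cinner x y + z * cinner (S z (T x)) y) has_fps_expansion
        (fps_const (cinner x y) + fps_X * ?F (T x))"
      by (intro fps_expansion_intros exp)
    ultimately have "?F x = fps_const (cinner x y) + fps_X * ?F (T x)"
      using fps_expansion_unique_complex exp[of x] by presburger
    then have "fps_nth (?F x) (Suc n) = fps_nth (?F (T x)) n" by simp
    also have "\<dots> = cinner ((blinfun_apply T ^^ Suc n) x) y"
      using Suc[of "T x"] by (simp add: funpow_swap1)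
    finally show ?case .
  qed (use left[of 0] in \<open>simp add: fps_expansion_def\<close>)
  \<comment> \<open>Cauchy's inequality holds for every \<open>y\<close> with a constant proportional to \<open>\<parallel>y\<parallel>\<close>, so \<open>y = T\<^sup>n x\<close> may
    vary with \<open>n\<close>.\<close>
  have decay: "\<exists>C. \<forall>n. norm ((blinfun_apply T ^^ n) x) * R ^ n \<le> C" if R: "R > 0" for R
  proof -
    have "compact ((\<lambda>z. S z x) ` cball 0 R)"
      by (intro compact_continuous_image continuous_at_imp_continuous_on ballI)
         (auto simp: isCont_def cont)
    then obtain C where C: "\<And>z. cmod z \<le> R \<Longrightarrow> norm (S z x) \<le> C"
      by (force dest!: compact_imp_bounded simp: bounded_iff)
    have "norm ((blinfun_apply T ^^ n) x) * R ^ n \<le> C" for n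
    proof (cases "(blinfun_apply T ^^ n) x = 0")
      case True
      then show ?thesis using R order_trans[OF norm_ge_zero C[of 0]] by simp
    next
      case False
      let ?y = "(blinfun_apply T ^^ n) x"
      have "norm ((deriv ^^ n) (\<lambda>z. cinner (S z x) ?y) 0) \<le> fact n * (C * norm ?y) / R ^ n"
      proof (rule Cauchy_inequality[OF _ _ R])
        fix z :: complex assume "norm (0 - z) = R"
        then have "norm (S z x) \<le> C" using C[of z] by simp
        then show "norm (cinner (S z x) ?y) \<le> C * norm ?y"
          by (meson cinner_Cauchy_Schwarz mult_right_mono norm_ge_zero order_trans)
      qed (auto intro: holomorphic_on_subset[OF holo]
             holomorphic_on_imp_continuous_on[OF holomorphic_on_subset[OF holo]])
      moreover have "norm ((deriv ^^ n) (\<lambda>z. cinner (S z x) ?y) 0) = fact n * (norm ?y)\<^sup>2"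
        using coeffs[of x ?y n] by (simp add: fps_expansion_def cinner_self field_simps norm_mult norm_power)
      ultimately have "fact n * (norm ?y * (norm ?y * R ^ n)) \<le> fact n * (norm ?y * C)"
        using R by (simp add: power2_eq_square field_simps)
      then show ?thesis using False by simp
    qed
    then show ?thesis by blast
  qed
  show "T x = blinfun_apply 0 x"
  proof (rule ccontr)
    assume "T x \<noteq> blinfun_apply 0 x"
    then have Tx: "T x \<noteq> 0" and x: "x \<noteq> 0" by auto
    define c where "c = norm (T x) / norm x"
    have c: "c > 0" using Tx x by (simp add: c_def)
    \<comment> \<open>Any radius larger than \<open>1 / c\<close> contradicts the lower bound \<open>\<parallel>T\<^sup>n x\<parallel> \<ge> c\<^sup>n \<parallel>x\<parallel>\<close>.\<close>
    obtain C where C: "\<And>n. norm ((blinfun_apply T ^^ n) x) * (2 / c) ^ n \<le> C"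
      using decay[of "2 / c"] c by auto
    have "2 ^ n * norm x \<le> C" for n
    proof -
      have "2 ^ n * norm x = c ^ n * norm x * (2 / c) ^ n"
        using c by (simp add: power_divide)
      also have "\<dots> \<le> norm ((blinfun_apply T ^^ n) x) * (2 / c) ^ n"
        using c normal_power_lower_bound[OF normal, of x n] by (intro mult_right_mono) (auto simp: c_def)
      finally show ?thesis using C[of n] by linarith
    qed
    moreover obtain n where "C / norm x < 2 ^ n" using real_arch_pow[of 2 "C / norm x"] by auto
    ultimately show False using x by (smt (verit) divide_less_eq zero_less_norm_iff)
  qed
qed

section \<open>Polynomials of a normal operator\<close>

definition poly_op :: "complex poly \<Rightarrow> ('h :: complex_hilbert_space \<Rightarrow>\<^sub>L 'h) \<Rightarrow> 'h \<Rightarrow>\<^sub>L 'h" where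
  "poly_op p A = fold_coeffs (\<lambda>a B. a *\<^sub>C id_blinfun + (A o\<^sub>L B)) p 0"

lemma poly_op_0 [simp]: "poly_op 0 A = 0"
  by (simp add: poly_op_def)

lemma poly_op_pCons: "poly_op (pCons a p) A = a *\<^sub>C id_blinfun + (A o\<^sub>L poly_op p A)"
proof (cases "a = 0 \<and> p = 0")
  case True
  then show ?thesis by (auto intro!: blinfun_eqI)
next
  case False
  then show ?thesis by (auto simp: poly_op_def)
qed

lemma poly_op_pCons_apply [simp]:
  "blinfun_apply (poly_op (pCons a p) A) x = a *\<^sub>C x + A (poly_op p A x)"
  by (simp add: poly_op_pCons blinfun.add_left)

lemma poly_op_add: "poly_op (p + q) A = poly_op p A + poly_op q A"
  by (rule blinfun_eqI, induction p q rule: poly_induct2)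
     (auto simp: blinfun.add_left blinfun.add_right scaleC_add_left)

context
  fixes A :: "'h :: complex_hilbert_space \<Rightarrow>\<^sub>L 'h"
  assumes A: "A \<in> bounded_operators"
begin

lemma poly_op_smult: "poly_op (smult c p) A = c *\<^sub>C poly_op p A"
  by (rule blinfun_eqI, induction p)
     (auto simp: bounded_operatorsD[OF A] scaleC_add_right scaleC_scaleC)

lemma poly_op_diff: "poly_op (p - q) A = poly_op p A - poly_op q A"
  using poly_op_add[of "p - q" q A] by simp

lemma poly_op_sum: "poly_op (\<Sum>i\<in>I. p i) A = (\<Sum>i\<in>I. poly_op (p i) A)"
  by (induction I rule: infinite_finite_induct) (auto simp: poly_op_add)

lemma poly_op_mult: "poly_op (p * q) A = poly_op p A o\<^sub>L poly_op q A"
  by (rule blinfun_eqI, induction p)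
     (auto simp: poly_op_add poly_op_smult blinfun.add_left)

lemma poly_op_bounded_operators: "poly_op p A \<in> bounded_operators"
  by (induction p) (auto simp: poly_op_pCons intro!: bounded_operators_closed A)

end

lemma poly_op_1: "poly_op 1 A = id_blinfun"
  by (auto simp: one_pCons intro!: blinfun_eqI)

lemma poly_op_X: "poly_op [:0, 1:] A = A"
  by (auto intro!: blinfun_eqI)

lemma poly_op_commute:
  assumes "A \<in> bounded_operators" "C \<in> bounded_operators" "A o\<^sub>L C = C o\<^sub>L A"
  shows "poly_op p A o\<^sub>L C = C o\<^sub>L poly_op p A"
proof (rule blinfun_eqI)
  have AC: "A (C x) = C (A x)" for x
    using assms(3) by (metis blinfun_apply_blinfun_compose)
  show "(poly_op p A o\<^sub>L C) x = (C o\<^sub>L poly_op p A) x" for x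
    by (induction p) (auto simp: AC blinfun.add_right bounded_operatorsD[OF assms(2)])
qed

lemma hilbert_adjoint_compose:
  assumes "A \<in> bounded_operators" "B \<in> bounded_operators"
  shows "hilbert_adjoint (A o\<^sub>L B) = hilbert_adjoint B o\<^sub>L hilbert_adjoint A"
  by (rule hilbert_adjoint_eqI) (simp add: cinner_adjoint[OF assms(1)] cinner_adjoint[OF assms(2)])

lemma hilbert_adjoint_adjoint:
  assumes "A \<in> bounded_operators"
  shows "hilbert_adjoint (hilbert_adjoint A) = A"
  by (rule hilbert_adjoint_eqI) (simp add: cinner_adjoint'[OF assms])

text \<open>
  \<open>p(N)\<close> commutes with \<open>N\<^sup>*\<close>; taking adjoints, \<open>N\<close> commutes with \<open>p(N)\<^sup>*\<close>, hence so does \<open>p(N)\<close>.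
\<close>

lemma normal_operator_poly_op:
  assumes "normal_operator N"
  shows "normal_operator (poly_op p N)"
proof -
  have N: "N \<in> bounded_operators" using assms by (simp add: normal_operator_def)
  note P = poly_op_bounded_operators[OF N, of p]
  have "poly_op p N o\<^sub>L hilbert_adjoint N = hilbert_adjoint N o\<^sub>L poly_op p N"
    using assms by (intro poly_op_commute) (auto simp: normal_operator_def bounded_operators_adjoint)
  then have "hilbert_adjoint (hilbert_adjoint N o\<^sub>L poly_op p N)
      = hilbert_adjoint (poly_op p N o\<^sub>L hilbert_adjoint N)" by simp
  then have "N o\<^sub>L hilbert_adjoint (poly_op p N) = hilbert_adjoint (poly_op p N) o\<^sub>L N"
    by (simp add: hilbert_adjoint_compose N P bounded_operators_adjoint hilbert_adjoint_adjoint)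
  then show ?thesis
    using poly_op_commute[OF N bounded_operators_adjoint[OF P]] P
    by (auto simp: normal_operator_def)
qed

lemma blinfun_compose_assoc: "(A o\<^sub>L B) o\<^sub>L C = A o\<^sub>L (B o\<^sub>L C)"
  by (rule blinfun_eqI) simp

lemma blinfun_compose_id [simp]: "A o\<^sub>L id_blinfun = A" "id_blinfun o\<^sub>L A = A"
  by (auto intro!: blinfun_eqI)

text \<open>
  Factor \<open>q\<close> into linear factors \<open>X - r\<close>: each \<open>N - r\<close> is invertible since \<open>r\<close> lies outside the
  spectrum.
\<close>

lemma poly_op_invertible:
  assumes N: "N \<in> bounded_operators"
    and "q \<noteq> 0" and "\<And>z. z \<in> op_spectrum N \<Longrightarrow> poly q z \<noteq> 0"
  shows "\<exists>S \<in> bounded_operators. S o\<^sub>L poly_op q N = id_blinfun \<and> poly_op q N o\<^sub>L S = id_blinfun"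
  using assms(2,3)
proof (induction "degree q" arbitrary: q)
  case 0
  then obtain c where q: "q = [:c:]" and c: "c \<noteq> 0" by (metis degree_eq_zeroE pCons_0_0)
  show ?case
  proof (intro bexI conjI)
    show "(1 / c) *\<^sub>C id_blinfun \<in> bounded_operators"
      by (intro bounded_operators_closed)
  qed (use c in \<open>auto simp: q scaleC_scaleC intro!: blinfun_eqI\<close>)
next
  case (Suc d)
  have "\<not> constant (poly q)" using Suc.hyps by (simp add: Fundamental_Theorem_Algebra.constant_degree)
  then obtain r where r: "poly q r = 0" using Fundamental_Theorem_Algebra.fundamental_theorem_of_algebra by blast
  then obtain q' where q': "q = [:- r, 1:] * q'" by (auto simp: poly_eq_0_iff_dvd)
  have "q' \<noteq> 0" using Suc.prems q' by auto
  then have "degree q = 1 + degree q'" unfolding q' by (subst degree_mult_eq) auto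
  then have "degree q' = d" using Suc.hyps by simp
  then obtain S where S: "S \<in> bounded_operators" "S o\<^sub>L poly_op q' N = id_blinfun"
      "poly_op q' N o\<^sub>L S = id_blinfun"
    using Suc.hyps(1)[of q'] Suc.prems(2) \<open>q' \<noteq> 0\<close> q' by auto
  have "r \<notin> op_spectrum N" using Suc.prems(2) r by blast
  then obtain B where B: "B \<in> bounded_operators" "(N - r *\<^sub>C id_blinfun) o\<^sub>L B = id_blinfun"
      "B o\<^sub>L (N - r *\<^sub>C id_blinfun) = id_blinfun"
    by (auto simp: op_spectrum_def)
  have "poly_op [:- r, 1:] N = N - r *\<^sub>C id_blinfun"
    by (auto intro!: blinfun_eqI simp: blinfun.diff_left scaleC_minus_left)
  then have q: "poly_op q N = (N - r *\<^sub>C id_blinfun) o\<^sub>L poly_op q' N"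
    by (simp only: q' poly_op_mult[OF N])
  show ?case
  proof (intro bexI conjI)
    have "(S o\<^sub>L B) o\<^sub>L poly_op q N = S o\<^sub>L (B o\<^sub>L (N - r *\<^sub>C id_blinfun)) o\<^sub>L poly_op q' N"
      by (simp only: q blinfun_compose_assoc)
    then show "(S o\<^sub>L B) o\<^sub>L poly_op q N = id_blinfun" by (simp add: B S)
    have "poly_op q N o\<^sub>L (S o\<^sub>L B) = (N - r *\<^sub>C id_blinfun) o\<^sub>L (poly_op q' N o\<^sub>L S) o\<^sub>L B"
      by (simp only: q blinfun_compose_assoc)
    then show "poly_op q N o\<^sub>L (S o\<^sub>L B) = id_blinfun" by (simp add: B S)
  qed (intro bounded_operators_closed S B)
qed

text \<open>
  For every \<open>z\<close> the polynomial \<open>1 - z q\<close> is \<open>1\<close> on the spectrum, so \<open>1 - z q(N)\<close> is invertible, and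
  the normal operator \<open>q(N)\<close> is quasinilpotent. Only when \<open>q\<close> is constant can \<open>1 - z q\<close> be the zero
  polynomial; that case is reduced to \<open>q X\<close> and \<open>q (X - 1)\<close>, whose difference is \<open>q\<close>.
\<close>

theorem poly_op_eq_0_if_vanishes_on_spectrum:
  assumes N: "normal_operator N" and q: "\<And>z. z \<in> op_spectrum N \<Longrightarrow> poly q z = 0"
  shows "poly_op q N = 0"
proof -
  have Nb: "N \<in> bounded_operators" using N by (simp add: normal_operator_def)
  have nonconst: "poly_op q N = 0"
    if q: "\<And>z. z \<in> op_spectrum N \<Longrightarrow> poly q z = 0" and deg: "degree q > 0" for q
  proof (rule normal_quasinilpotent_eq_0[OF normal_operator_poly_op[OF N]])
    fix z
    have "1 - smult z q \<noteq> 0"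
    proof
      assume "1 - smult z q = 0"
      then have "smult z q = 1" by simp
      then have "degree (smult z q) = 0" "z \<noteq> 0" by auto
      then show False using deg by simp
    qed
    moreover have "poly (1 - smult z q) u \<noteq> 0" if "u \<in> op_spectrum N" for u
      using q[OF that] by simp
    ultimately obtain S where "S \<in> bounded_operators"
        "S o\<^sub>L poly_op (1 - smult z q) N = id_blinfun" "poly_op (1 - smult z q) N o\<^sub>L S = id_blinfun"
      using poly_op_invertible[OF Nb] by meson
    then show "\<exists>S \<in> bounded_operators. S o\<^sub>L (id_blinfun - z *\<^sub>C poly_op q N) = id_blinfun \<and>
        (id_blinfun - z *\<^sub>C poly_op q N) o\<^sub>L S = id_blinfun"
      by (auto simp: poly_op_diff[OF Nb] poly_op_smult[OF Nb] poly_op_1)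
  qed
  show ?thesis
  proof (cases "degree q > 0 \<or> q = 0")
    case False
    then have "poly_op (q * [:0, 1:]) N = 0" "poly_op (q * [:-1, 1:]) N = 0"
      by (intro nonconst; simp add: q degree_mult_eq del: mult_pCons_right)+
    moreover have "q = q * [:0, 1:] - q * [:-1, 1:]"
      by (simp flip: right_diff_distrib)
    ultimately show ?thesis by (metis Nb poly_op_diff diff_zero)
  qed (use nonconst q in auto)
qed

section \<open>The spectral projections of a normal operator with finite spectrum\<close>

text \<open>
  Lagrange's interpolation polynomial of the indicator function of \<open>B\<close> at the nodes \<open>S\<close>.
\<close>

definition indicator_poly :: "complex set \<Rightarrow> complex set \<Rightarrow> complex poly" where
  "indicator_poly S B = (\<Sum>a\<in>S \<inter> B. \<Prod>b\<in>S - {a}. smult (1 / (a - b)) [:- b, 1:])"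

lemma poly_indicator_poly:
  assumes "finite S" "z \<in> S"
  shows "poly (indicator_poly S B) z = of_bool (z \<in> B)"
proof -
  have "poly (\<Prod>b\<in>S - {a}. smult (1 / (a - b)) [:- b, 1:]) z = of_bool (z = a)" for a
  proof (cases "z = a")
    case False
    then show ?thesis using assms by (auto simp: poly_prod intro!: prod_zero bexI[of _ z])
  qed (auto simp: poly_prod intro!: prod.neutral simp flip: diff_divide_distrib split: if_splits)
  then have "poly (indicator_poly S B) z = (\<Sum>a\<in>S \<inter> B. of_bool (z = a))"
    by (simp add: indicator_poly_def poly_sum)
  also have "\<dots> = of_bool (z \<in> B)"
    using assms by (auto simp: of_bool_def sum.delta')
  finally show ?thesis .
qed

definition spectral_part ::
    "('h :: complex_hilbert_space \<Rightarrow>\<^sub>L 'h) \<Rightarrow> complex set \<Rightarrow> 'h \<Rightarrow>\<^sub>L 'h" where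
  "spectral_part N B = poly_op (indicator_poly (op_spectrum N) B) N"

lemma spectral_part_disjoint:
  assumes "op_spectrum N \<inter> B = {}"
  shows "spectral_part N B = 0"
  by (simp add: spectral_part_def indicator_poly_def assms)

text \<open>
  The kernel of \<open>P\<close> is also the kernel of \<open>P\<^sup>*\<close>, by normality. It contains every \<open>P x - x\<close>, hence
  \<open>P\<^sup>* = P\<^sup>* P\<close>, which is self-adjoint.
\<close>

lemma adjoint_normal_idempotent:
  assumes P: "normal_operator P" and idem: "P o\<^sub>L P = P"
  shows "hilbert_adjoint P = P"
proof (rule hilbert_adjoint_eqI)
  fix x y
  have Pb: "P \<in> bounded_operators" using P by (simp add: normal_operator_def)
  have PP: "P (P x) = P x" for x using idem by (metis blinfun_apply_blinfun_compose)
  have adj: "hilbert_adjoint P (P x) = hilbert_adjoint P x" for x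
  proof -
    have "norm (hilbert_adjoint P (P x - x)) = 0"
      unfolding norm_adjoint_eq_if_normal[OF P] by (simp add: blinfun.diff_right PP)
    then show ?thesis by (metis blinfun.diff_right norm_eq_zero eq_iff_diff_eq_0)
  qed
  have *: "cinner (P x) y = cinner (P x) (P y)" for x y
    by (metis Pb adj cinner_adjoint)
  show "cinner (P x) y = cinner x (P y)"
    using *[of x y] *[of y x] by (metis cinner_commute)
qed

lemma cinner_projection:
  assumes "is_projection P"
  shows "cinner (blinfun_apply P x) x = of_real ((norm (P x))\<^sup>2)"
proof -
  have "P \<in> bounded_operators" "P (P x) = P x" "hilbert_adjoint P = P"
    using assms by (auto simp: is_projection_def) (metis blinfun_apply_blinfun_compose)
  then show ?thesis by (metis cinner_adjoint cinner_self)
qed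

context
  fixes N :: "'h :: complex_hilbert_space \<Rightarrow>\<^sub>L 'h"
  assumes N: "normal_operator N" and fin: "finite (op_spectrum N)"
begin

lemma N_bounded_operators: "N \<in> bounded_operators"
  using N by (simp add: normal_operator_def)

text \<open>
  The functional calculus: relations between the operators \<open>spectral_part N B\<close> are read off from the
  corresponding indicator functions on the spectrum.
\<close>

lemma poly_op_cong_on_spectrum:
  assumes "\<And>z. z \<in> op_spectrum N \<Longrightarrow> poly p z = poly q z"
  shows "poly_op p N = poly_op q N"
  using poly_op_eq_0_if_vanishes_on_spectrum[OF N, of "p - q"] assms
  by (simp add: poly_op_diff[OF N_bounded_operators])

lemma spectral_part_inter:
  "spectral_part N (A \<inter> B) = spectral_part N A o\<^sub>L spectral_part N B"
  unfolding spectral_part_def poly_op_mult[OF N_bounded_operators, symmetric]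
  by (rule poly_op_cong_on_spectrum) (auto simp: poly_indicator_poly[OF fin])

lemma spectral_part_superset:
  assumes "op_spectrum N \<subseteq> B"
  shows "spectral_part N B = id_blinfun"
  unfolding spectral_part_def poly_op_1[symmetric, of N]
  by (rule poly_op_cong_on_spectrum) (use assms in \<open>auto simp: poly_indicator_poly[OF fin]\<close>)

lemma spectral_part_eq_sum:
  "spectral_part N B = (\<Sum>a\<in>op_spectrum N. if a \<in> B then spectral_part N {a} else 0)"
proof -
  have "spectral_part N B = (\<Sum>a\<in>op_spectrum N \<inter> B. spectral_part N {a})"
    unfolding spectral_part_def poly_op_sum[OF N_bounded_operators, symmetric]
    by (rule poly_op_cong_on_spectrum)
       (auto simp: poly_indicator_poly[OF fin] poly_sum fin of_bool_def)
  then show ?thesis by (simp add: sum.If_cases fin Int_def)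
qed

lemma spectral_part_eigen: "N o\<^sub>L spectral_part N {a} = a *\<^sub>C spectral_part N {a}"
proof -
  have "poly_op ([:0, 1:] * indicator_poly (op_spectrum N) {a}) N
      = poly_op (smult a (indicator_poly (op_spectrum N) {a})) N"
    by (rule poly_op_cong_on_spectrum) (auto simp: poly_indicator_poly[OF fin])
  then show ?thesis
    by (simp only: spectral_part_def poly_op_mult poly_op_smult N_bounded_operators poly_op_X)
qed

lemma is_projection_spectral_part: "is_projection (spectral_part N B)"
proof -
  have "spectral_part N B o\<^sub>L spectral_part N B = spectral_part N B"
    using spectral_part_inter[of B B] by simp
  moreover have "normal_operator (spectral_part N B)"
    unfolding spectral_part_def by (rule normal_operator_poly_op[OF N])
  ultimately show ?thesis
    unfolding is_projection_def using adjoint_normal_idempotent normal_operator_def by blast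
qed

lemma spectral_part_decomposition:
  "(\<Sum>a\<in>op_spectrum N. spectral_part N {a}) = id_blinfun"
  using spectral_part_eq_sum[of UNIV] spectral_part_superset[of UNIV] by simp

lemma apply_eq_sum_spectral_part:
  "N x = (\<Sum>a\<in>op_spectrum N. a *\<^sub>C spectral_part N {a} x)"
proof -
  have "N x = (N o\<^sub>L (\<Sum>a\<in>op_spectrum N. spectral_part N {a})) x"
    by (simp add: spectral_part_decomposition)
  also have "\<dots> = (\<Sum>a\<in>op_spectrum N. (N o\<^sub>L spectral_part N {a}) x)"
    by (simp add: blinfun.sum_left blinfun.sum_right)
  finally show ?thesis by (simp add: spectral_part_eigen)
qed

lemma projection_valued_measure_spectral_part: "projection_valued_measure (spectral_part N)"
  unfolding projection_valued_measure_def
proof (intro conjI ballI allI impI)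
  fix B :: "nat \<Rightarrow> complex set" and x
  assume disj: "disjoint_family B"
  have "(\<lambda>i. if a \<in> B i then spectral_part N {a} x else 0) sums
      (if a \<in> (\<Union>i. B i) then spectral_part N {a} x else 0)" for a
  proof (cases "\<exists>j. a \<in> B j")
    case True
    then obtain j where "a \<in> B j" by blast
    then have "a \<in> B i \<longleftrightarrow> i = j" for i using disj by (auto simp: disjoint_family_on_def)
    then show ?thesis using sums_single[of j "\<lambda>_. spectral_part N {a} x"] by auto
  qed auto
  then have "(\<lambda>i. \<Sum>a\<in>op_spectrum N. if a \<in> B i then spectral_part N {a} x else 0) sums
      (\<Sum>a\<in>op_spectrum N. if a \<in> (\<Union>i. B i) then spectral_part N {a} x else 0)"
    by (intro sums_sum)
  moreover have "spectral_part N C x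
      = (\<Sum>a\<in>op_spectrum N. if a \<in> C then spectral_part N {a} x else 0)" for C
    by (subst spectral_part_eq_sum) (auto simp: blinfun.sum_left intro!: sum.cong)
  ultimately show "(\<lambda>i. spectral_part N (B i) x) sums spectral_part N (\<Union>i. B i) x" by simp
qed (auto simp: is_projection_spectral_part spectral_part_inter spectral_part_superset
      spectral_part_disjoint)

end

section \<open>Uniqueness of the spectral measure at eigenvalues\<close>

context
  fixes E :: "complex set \<Rightarrow> ('h :: complex_hilbert_space \<Rightarrow>\<^sub>L 'h)"
  assumes E: "projection_valued_measure E"
begin

lemma pvm_projection: "B \<in> sets borel \<Longrightarrow> is_projection (E B)"
  using E by (simp add: projection_valued_measure_def)

lemma pvm_inter:
  "A \<in> sets borel \<Longrightarrow> B \<in> sets borel \<Longrightarrow> E A (E B x) = E (A \<inter> B) x"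
  using E by (simp add: projection_valued_measure_def)

lemma pvm_empty: "E {} = 0" and pvm_UNIV: "E UNIV = id_blinfun"
  using E by (simp_all add: projection_valued_measure_def)

lemma pvm_sums:
  "range B \<subseteq> sets borel \<Longrightarrow> disjoint_family B \<Longrightarrow> (\<lambda>i. E (B i) x) sums E (\<Union>i. B i) x"
  using E by (simp add: projection_valued_measure_def)

lemma
  shows sets_scalar_measure [measurable_cong]: "sets (scalar_measure E x) = sets borel"
    and space_scalar_measure [simp]: "space (scalar_measure E x) = UNIV"
    and emeasure_scalar_measure: "B \<in> sets borel \<Longrightarrow>
      emeasure (scalar_measure E x) B = ennreal ((norm (E B x))\<^sup>2)"
proof -
  have borel: "sigma_algebra UNIV (sets (borel :: complex measure))"
    using sets.sigma_algebra_axioms[of "borel :: complex measure"] by simp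
  show "sets (scalar_measure E x) = sets borel"
    using sigma_algebra.sets_measure_of_eq[OF borel] by (simp add: scalar_measure_def)
  show "space (scalar_measure E x) = UNIV"
    by (simp add: scalar_measure_def space_measure_of_conv)
  have Re: "Re (cinner (E B x) x) = (norm (E B x))\<^sup>2" if "B \<in> sets borel" for B
    using cinner_projection[OF pvm_projection[OF that], of x] by simp
  assume B: "B \<in> sets borel"
  have "emeasure (scalar_measure E x) B = ennreal (Re (cinner (E B x) x))"
    unfolding scalar_measure_def
  proof (rule emeasure_measure_of_sigma[OF borel _ _ B])
    show "countably_additive (sets borel) (\<lambda>B. ennreal (Re (cinner (E B x) x)))"
    proof (rule countably_additiveI)
      fix A :: "nat \<Rightarrow> complex set"
      assume A: "range A \<subseteq> sets borel" "disjoint_family A"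
      have "(\<lambda>i. Re (cinner (E (A i) x) x)) sums Re (cinner (E (\<Union>i. A i) x) x)"
        by (intro sums_Re bounded_linear.sums[OF bounded_linear_cinner_left] pvm_sums A)
      then show "(\<Sum>i. ennreal (Re (cinner (E (A i) x) x))) = ennreal (Re (cinner (E (\<Union>i. A i) x) x))"
        using A by (intro suminf_ennreal_eq) (auto simp: Re)
    qed
  qed (simp add: positive_def pvm_empty)
  then show "emeasure (scalar_measure E x) B = ennreal ((norm (E B x))\<^sup>2)" by (simp add: Re B)
qed

lemma measure_scalar_measure:
  "B \<in> sets borel \<Longrightarrow> measure (scalar_measure E x) B = (norm (E B x))\<^sup>2"
  by (simp add: measure_def emeasure_scalar_measure)

lemma finite_measure_scalar_measure: "finite_measure (scalar_measure E x)"
  by (rule finite_measureI) (simp add: emeasure_scalar_measure)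

lemma AE_scalar_measure_iff:
  assumes "B \<in> sets borel"
  shows "(AE z in scalar_measure E x. z \<in> B) \<longleftrightarrow> E (- B) x = 0"
proof -
  have "(AE z in scalar_measure E x. z \<in> B) \<longleftrightarrow> emeasure (scalar_measure E x) (- B) = 0"
    using assms by (intro AE_iff_measurable) (auto simp: sets_scalar_measure)
  then show ?thesis using assms by (simp add: emeasure_scalar_measure borel_comp)
qed

lemma pvm_Compl:
  assumes "B \<in> sets borel"
  shows "E B x + E (- B) x = x"
proof -
  have "(\<lambda>i. E (binaryset B (- B) i) x) sums E (\<Union>i. binaryset B (- B) i) x"
    using assms by (intro pvm_sums) (auto simp: range_binaryset_eq disjoint_family_on_def binaryset_def)
  moreover have "(\<lambda>i. E (binaryset B (- B) i) x) sums (E B x + E (- B) x)"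
    by (rule binaryset_sums) (simp add: pvm_empty)
  ultimately show ?thesis by (metis sums_unique2 UN_binaryset_eq Compl_partition pvm_UNIV blinfun_apply_id_blinfun id_apply)
qed

text \<open>
  Both measures give \<open>\<parallel>E(A \<inter> B) x\<parallel>\<^sup>2\<close> to a Borel set \<open>A\<close>, by multiplicativity of \<open>E\<close>.
\<close>

lemma scalar_measure_projection:
  assumes B: "B \<in> sets borel"
  shows "scalar_measure E (E B x) = density (scalar_measure E x) (indicator B)"
proof (rule measure_eqI)
  fix A assume "A \<in> sets (scalar_measure E (E B x))"
  then have A: "A \<in> sets borel" by (simp add: sets_scalar_measure)
  then show "emeasure (scalar_measure E (E B x)) A
      = emeasure (density (scalar_measure E x) (indicator B)) A"
    using B by (simp add: emeasure_scalar_measure emeasure_density sets_scalar_measure pvm_inter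
        Int_commute flip: indicator_inter_arith)
qed (simp add: sets_scalar_measure)

end

text \<open>
  A measure carried by a finite set integrates the identity to a finite sum, which for
  \<open>spectral_part N\<close> is the eigenspace decomposition of the form of \<open>N\<close>.
\<close>

lemma is_spectral_measure_of_spectral_part:
  assumes N: "normal_operator N" and fin: "finite (op_spectrum N)"
  shows "is_spectral_measure_of (spectral_part N) N"
  unfolding is_spectral_measure_of_def
proof (intro conjI allI)
  show pvm: "projection_valued_measure (spectral_part N)"
    by (rule projection_valued_measure_spectral_part[OF N fin])
  fix x
  let ?m = "scalar_measure (spectral_part N) x" and ?S = "op_spectrum N"
  interpret finite_measure ?m by (rule finite_measure_scalar_measure[OF pvm])
  note [measurable_cong] = sets_scalar_measure[OF pvm, of x]
  have meas: "A \<in> sets ?m" if "A \<in> sets borel" for A using that sets_scalar_measure[OF pvm] by simp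
  have "AE z in ?m. z \<in> ?S"
    using AE_scalar_measure_iff[OF pvm, of ?S x] fin
    by (simp add: spectral_part_disjoint borel_closed finite_imp_closed)
  then have AE: "AE z in ?m. z = (\<Sum>a\<in>?S. indicator {a} z *\<^sub>R a)"
  proof eventually_elim
    case (elim z)
    have "(\<Sum>a\<in>?S. indicator {a} z *\<^sub>R a) = (\<Sum>a\<in>?S. if z = a then a else 0)"
      by (intro sum.cong) auto
    then show ?case using elim fin by simp
  qed
  have int: "integrable ?m (\<lambda>z. \<Sum>a\<in>?S. indicator {a} z *\<^sub>R a)"
    by (intro Bochner_Integration.integrable_sum integrable_scaleR_left integrable_real_indicator meas)
       (auto simp: less_top[symmetric])
  show "integrable ?m (\<lambda>z. z)"
    by (rule integrable_cong_AE_imp[OF int]) (use AE in \<open>auto simp: eq_commute\<close>)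
  have "(LINT z|?m. z) = (LINT z|?m. (\<Sum>a\<in>?S. indicator {a} z *\<^sub>R a))"
    using AE by (intro integral_cong_AE) auto
  also have "\<dots> = (\<Sum>a\<in>?S. measure ?m {a} *\<^sub>R a)"
    by (subst Bochner_Integration.integral_sum)
       (auto simp: less_top[symmetric] meas intro!: integrable_scaleR_left integrable_real_indicator)
  also have "\<dots> = (\<Sum>a\<in>?S. a * cinner (spectral_part N {a} x) x)"
    by (intro sum.cong)
       (auto simp: measure_scalar_measure[OF pvm] cinner_projection[OF pvm_projection[OF pvm]]
          scaleR_conv_of_real mult.commute)
  also have "\<dots> = cinner (N x) x"
    by (subst apply_eq_sum_spectral_part[OF N fin]) (simp add: cinner_sum_left cinner_scaleC_left)
  finally show "cinner (N x) x = (LINT z|?m. z)" ..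
qed

text \<open>
  Cutting \<open>x\<close> with \<open>E B\<close> restricts its scalar measure to \<open>B\<close>, so the form of \<open>N\<close> is the sum of its
  compressions to the ranges of \<open>E B\<close> and \<open>E (- B)\<close>; by polarization so is \<open>N\<close>.
\<close>

lemma spectral_measure_commute:
  assumes N: "N \<in> bounded_operators" and EN: "is_spectral_measure_of E N" and B: "B \<in> sets borel"
  shows "blinfun_apply (E B) (N x) = N (E B x)"
proof -
  have pvm: "projection_valued_measure E"
    and int: "integrable (scalar_measure E x) (\<lambda>z. z)"
    and form: "cinner (N x) x = (LINT z|scalar_measure E x. z)" for x
    using EN by (auto simp: is_spectral_measure_of_def)
  have B': "- B \<in> sets borel" using B by (rule borel_comp)
  have cut: "cinner (N (E C v)) (E C v) = (LINT z|scalar_measure E v. indicator C z *\<^sub>R z)"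
    if C: "C \<in> sets borel" for C v
    unfolding form scalar_measure_projection[OF pvm C]
    using C integral_density[of "\<lambda>z. z" "scalar_measure E v" "indicator C"] sets_scalar_measure[OF pvm, of v]
      borel_measurable_integrable[OF int, of v] by (simp add: ennreal_indicator)
  let ?D = "N - ((E B o\<^sub>L (N o\<^sub>L E B)) + (E (- B) o\<^sub>L (N o\<^sub>L E (- B))))"
  have Eb: "E C \<in> bounded_operators" and Esa: "cinner (E C u) v = cinner u (E C v)"
    if "C \<in> sets borel" for C u v
    using pvm_projection[OF pvm that] by (auto simp: is_projection_def) (metis cinner_adjoint)
  have "?D = 0"
  proof (rule operator_eq_0_if_form_eq_0)
    show "?D \<in> bounded_operators" by (intro bounded_operators_closed N Eb B B')
    fix v
    have "cinner (N v) v = (LINT z|scalar_measure E v. indicator B z *\<^sub>R z + indicator (- B) z *\<^sub>R z)"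
      unfolding form by (intro Bochner_Integration.integral_cong) (auto simp: indicator_def)
    also have "\<dots> = cinner (N (E B v)) (E B v) + cinner (N (E (- B) v)) (E (- B) v)"
      unfolding cut[OF B] cut[OF B'] using B B' sets_scalar_measure[OF pvm]
      by (intro Bochner_Integration.integral_add integrable_mult_indicator int) auto
    finally show "cinner (?D v) v = 0"
      by (simp add: blinfun.diff_left blinfun.add_left cinner_simps Esa B B')
  qed
  then have N_eq: "N v = E B (N (E B v)) + E (- B) (N (E (- B) v))" for v
    by (metis (no_types, lifting) blinfun.add_left blinfun_apply_blinfun_compose eq_iff_diff_eq_0)
  have "E B (N x) = E B (N (E B x))"
    by (subst N_eq[of x]) (simp add: blinfun.add_right pvm_inter[OF pvm] B B' pvm_empty[OF pvm])
  also have "\<dots> = N (E B x)"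
    using N_eq[of "E B x"] by (simp add: pvm_inter[OF pvm] B B' pvm_empty[OF pvm])
  finally show ?thesis .
qed

text \<open>
  The scalar measure of an eigenvector \<open>u\<close> has its barycentre at the eigenvalue \<open>a\<close>, so it cannot
  be carried by an open half-plane with \<open>a\<close> on its boundary.
\<close>

lemma eigenvector_in_half_plane_eq_0:
  assumes EN: "is_spectral_measure_of E N" and eigen: "blinfun_apply N u = a *\<^sub>C u"
    and u: "E {z. Re (c * (z - a)) > 0} u = u"
  shows "u = 0"
proof -
  define H where "H = {z. Re (c * (z - a)) > 0}"
  have H: "H \<in> sets borel" unfolding H_def by measurable
  have pvm: "projection_valued_measure E"
    and int: "integrable (scalar_measure E u) (\<lambda>z. z)"
    and form: "cinner (N u) u = (LINT z|scalar_measure E u. z)"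
    using EN by (auto simp: is_spectral_measure_of_def)
  interpret finite_measure "scalar_measure E u" by (rule finite_measure_scalar_measure[OF pvm])
  have mass: "measure (scalar_measure E u) UNIV = (norm u)\<^sup>2"
    using measure_scalar_measure[OF pvm, of UNIV u] by (simp add: pvm_UNIV[OF pvm])
  have int': "integrable (scalar_measure E u) (\<lambda>z. c * (z - a))"
    using int by simp
  have "(LINT z|scalar_measure E u. Re (c * (z - a))) = Re (LINT z|scalar_measure E u. c * (z - a))"
    using int' by (rule integral_Re)
  also have "(LINT z|scalar_measure E u. c * (z - a)) = c * (cinner (N u) u - of_real ((norm u)\<^sup>2) * a)"
    using int by (simp add: form mass space_scalar_measure[OF pvm] scaleR_conv_of_real)
  also have "\<dots> = 0"
    by (simp add: eigen cinner_scaleC_left cinner_self)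
  finally have zero: "(LINT z|scalar_measure E u. Re (c * (z - a))) = 0" by simp
  have "E (- H) u = 0"
    using pvm_Compl[OF pvm H, of u] u by (simp add: H_def)
  then have pos: "AE z in scalar_measure E u. Re (c * (z - a)) > 0"
    using AE_scalar_measure_iff[OF pvm H, of u] by (simp add: H_def)
  have nonneg: "AE z in scalar_measure E u. 0 \<le> Re (c * (z - a))"
    using pos by eventually_elim (rule less_imp_le)
  have "AE z in scalar_measure E u. Re (c * (z - a)) = 0"
    using integral_nonneg_eq_0_iff_AE[OF integrable_Re[OF int'] nonneg] zero by (rule iffD1)
  with pos have "AE z in scalar_measure E u. z \<in> {}" by eventually_elim simp
  then show "u = 0"
    using AE_scalar_measure_iff[OF pvm, of "{}" u] by (simp add: pvm_UNIV[OF pvm])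
qed

text \<open>
  As \<open>E\<close> commutes with \<open>N\<close>, the part of \<open>u\<close> in a half-plane is again an eigenvector for \<open>a\<close>, hence zero
  if \<open>a\<close> lies on the boundary. The half-planes to the right, to the left, above and below cover
  everything except \<open>a\<close>.
\<close>

lemma spectral_measure_eigenvector:
  assumes N: "N \<in> bounded_operators" and EN: "is_spectral_measure_of E N"
    and eigen: "blinfun_apply N u = a *\<^sub>C u"
  shows "E {a} u = u"
proof -
  have pvm: "projection_valued_measure E" using EN by (simp add: is_spectral_measure_of_def)
  define H where "H c = {z. Re (c * (z - a)) > 0}" for c
  have H [measurable]: "H c \<in> sets borel" for c unfolding H_def by measurable
  have "E (H c) u = 0" for c
  proof (rule eigenvector_in_half_plane_eq_0[OF EN])
    show "N (E (H c) u) = a *\<^sub>C E (H c) u"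
      using spectral_measure_commute[OF N EN H, of c u] pvm_projection[OF pvm H, of c]
      by (simp add: eigen is_projection_def bounded_operatorsD)
    show "E {z. Re (c * (z - a)) > 0} (E (H c) u) = E (H c) u"
      using pvm_inter[OF pvm H H, of c c u] by (simp add: H_def)
  qed
  then have "AE z in scalar_measure E u. z \<in> - H c" for c
    using AE_scalar_measure_iff[OF pvm borel_comp[OF H], where x = u] by simp
  then have "AE z in scalar_measure E u. z \<in> - H 1 \<and> z \<in> - H (-1) \<and> z \<in> - H \<i> \<and> z \<in> - H (- \<i>)"
    by (intro AE_conjI)
  then have "AE z in scalar_measure E u. z \<in> {a}"
    by eventually_elim (auto simp: H_def complex_eq_iff)
  then show ?thesis
    using AE_scalar_measure_iff[OF pvm, of "{a}" u] pvm_Compl[OF pvm, of "{a}" u] by simp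
qed

text \<open>
  By the eigenvector lemma \<open>E {b}\<close> fixes the range of \<open>spectral_part N {b}\<close> for every \<open>b\<close>, and for
  \<open>b \<noteq> a\<close> the projection \<open>E {a}\<close> is orthogonal to \<open>E {b}\<close>. So \<open>E {a}\<close> picks the \<open>a\<close>-component out of
  the decomposition of \<open>x\<close> into eigenvectors.
\<close>

lemma spectral_projection_eq_spectral_part:
  assumes N: "normal_operator N" and fin: "finite (op_spectrum N)" and a: "a \<in> op_spectrum N"
  shows "spectral_projection N {a} = spectral_part N {a}"
  unfolding spectral_projection_def
proof (rule the_equality)
  show "\<exists>E. is_spectral_measure_of E N \<and> spectral_part N {a} = E {a}"
    using is_spectral_measure_of_spectral_part[OF N fin] by blast
  fix P assume "\<exists>E. is_spectral_measure_of E N \<and> P = E {a}"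
  then obtain E where EN: "is_spectral_measure_of E N" and P: "P = E {a}" by blast
  have Nb: "N \<in> bounded_operators" using N by (simp add: normal_operator_def)
  have pvm: "projection_valued_measure E" using EN by (simp add: is_spectral_measure_of_def)
  have range: "E {b} (spectral_part N {b} x) = spectral_part N {b} x" for b x
    using spectral_part_eigen[OF N fin, of b]
    by (intro spectral_measure_eigenvector[OF Nb EN])
       (metis blinfun_apply_blinfun_compose scaleC_blinfun_apply)
  show "P = spectral_part N {a}"
  proof (rule blinfun_eqI)
    fix x
    have "E {a} x = E {a} ((\<Sum>b\<in>op_spectrum N. spectral_part N {b}) x)"
      by (simp add: spectral_part_decomposition[OF N fin])
    also have "\<dots> = (\<Sum>b\<in>op_spectrum N. E {a} (E {b} (spectral_part N {b} x)))"
      by (simp add: blinfun.sum_left blinfun.sum_right range)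
    also have "\<dots> = (\<Sum>b\<in>op_spectrum N. if b = a then spectral_part N {a} x else 0)"
      by (intro sum.cong refl, subst pvm_inter[OF pvm])
         (auto simp: range pvm_empty[OF pvm])
    finally show "P x = spectral_part N {a} x" using a fin by (simp add: P)
  qed
qed

section \<open>Traces of compressions\<close>

context
  fixes M :: "('h :: complex_hilbert_space \<Rightarrow>\<^sub>L 'h) set" and \<tau>
  assumes M: "tracial_von_neumann_algebra M \<tau>"
begin

lemma
  shows M_id: "id_blinfun \<in> M"
    and M_add: "A \<in> M \<Longrightarrow> B \<in> M \<Longrightarrow> A + B \<in> M"
    and M_compose: "A \<in> M \<Longrightarrow> B \<in> M \<Longrightarrow> A o\<^sub>L B \<in> M"
    and M_scaleC: "A \<in> M \<Longrightarrow> c *\<^sub>C A \<in> M"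
    and trace_add: "A \<in> M \<Longrightarrow> B \<in> M \<Longrightarrow> \<tau> (A + B) = \<tau> A + \<tau> B"
    and trace_scaleC: "A \<in> M \<Longrightarrow> \<tau> (c *\<^sub>C A) = c * \<tau> A"
    and trace_pos: "A \<in> M \<Longrightarrow> 0 \<preceq> A \<Longrightarrow> 0 \<le> \<tau> A"
    and trace_commute: "A \<in> M \<Longrightarrow> B \<in> M \<Longrightarrow> \<tau> (A o\<^sub>L B) = \<tau> (B o\<^sub>L A)"
  using M by (auto simp: tracial_von_neumann_algebra_def von_neumann_algebra_def state_on_def
      tracial_on_def)

lemma M_0: "0 \<in> M" and trace_0: "\<tau> 0 = 0"
proof -
  have "0 = 0 *\<^sub>C (id_blinfun :: 'h \<Rightarrow>\<^sub>L 'h)" by (auto intro!: blinfun_eqI)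
  then show "0 \<in> M" "\<tau> 0 = 0" by (metis M_scaleC M_id, metis trace_scaleC M_id mult_zero_left)
qed

lemma M_diff: "A \<in> M \<Longrightarrow> B \<in> M \<Longrightarrow> A - B \<in> M"
  and trace_diff: "A \<in> M \<Longrightarrow> B \<in> M \<Longrightarrow> \<tau> (A - B) = \<tau> A - \<tau> B"
proof -
  assume AB: "A \<in> M" "B \<in> M"
  have eq: "A - B = A + (-1) *\<^sub>C B"
    by (rule blinfun_eqI) (simp add: blinfun.diff_left blinfun.add_left scaleC_minus_one)
  show "A - B \<in> M" unfolding eq by (intro M_add M_scaleC AB)
  show "\<tau> (A - B) = \<tau> A - \<tau> B" unfolding eq by (simp add: trace_add trace_scaleC M_scaleC AB)
qed

lemma
  assumes "\<And>i. i \<in> I \<Longrightarrow> A i \<in> M"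
  shows M_sum: "(\<Sum>i\<in>I. A i) \<in> M" and trace_sum: "\<tau> (\<Sum>i\<in>I. A i) = (\<Sum>i\<in>I. \<tau> (A i))"
proof -
  have "(\<Sum>i\<in>I. A i) \<in> M \<and> \<tau> (\<Sum>i\<in>I. A i) = (\<Sum>i\<in>I. \<tau> (A i))"
    using assms
    by (induction I rule: infinite_finite_induct) (auto simp: M_0 trace_0 M_add trace_add)
  then show "(\<Sum>i\<in>I. A i) \<in> M" "\<tau> (\<Sum>i\<in>I. A i) = (\<Sum>i\<in>I. \<tau> (A i))" by auto
qed

lemma M_poly_op: "N \<in> M \<Longrightarrow> poly_op p N \<in> M"
  by (induction p) (auto simp: poly_op_pCons M_0 intro!: M_add M_scaleC M_id M_compose)

text \<open>
  By traciality \<open>\<tau> (P X) = \<tau> (P X P)\<close>, and \<open>0 \<preceq> P X P \<preceq> P\<close>.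
\<close>

lemma trace_compression:
  assumes P: "is_projection P" "P \<in> M" and X: "X \<in> M" "0 \<preceq> X" "X \<preceq> id_blinfun"
  shows "0 \<le> \<tau> (P o\<^sub>L X)" and "\<tau> (P o\<^sub>L X) \<le> \<tau> P"
proof -
  have PP: "P o\<^sub>L P = P" using P by (simp add: is_projection_def)
  then have PPx: "P (P x) = P x" for x by (metis blinfun_apply_blinfun_compose)
  have sa: "cinner (P x) y = cinner x (P y)" for x y
    using P cinner_adjoint[of P x y] by (simp add: is_projection_def)
  let ?C = "(P o\<^sub>L X) o\<^sub>L P"
  have C: "?C \<in> M" by (intro M_compose P X)
  have "\<tau> (P o\<^sub>L X) = \<tau> (P o\<^sub>L (P o\<^sub>L X))" by (simp add: PP flip: blinfun_compose_assoc)
  also have "\<dots> = \<tau> ?C" by (intro trace_commute M_compose P X)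
  finally have eq: "\<tau> (P o\<^sub>L X) = \<tau> ?C" .
  have "0 \<preceq> ?C" using X(2) by (simp add: operator_le_def sa)
  then show "0 \<le> \<tau> (P o\<^sub>L X)" unfolding eq by (intro trace_pos C)
  have "cinner ((P - ?C) x) x = cinner ((id_blinfun - X) (P x)) (P x)" for x
    by (simp add: blinfun.diff_left cinner_diff_left sa PPx)
  then have "0 \<preceq> P - ?C" using X(3) by (simp add: operator_le_def)
  then have "0 \<le> \<tau> (P - ?C)" by (intro trace_pos M_diff P C)
  then show "\<tau> (P o\<^sub>L X) \<le> \<tau> P" unfolding eq by (simp add: trace_diff P C)
qed

end

section \<open>The \<open>\<alpha>\<close>-numerical range\<close>

lemma projection_combination_nonneg:
  assumes "\<And>k. k \<in> I \<Longrightarrow> is_projection (P k)" "\<And>k. k \<in> I \<Longrightarrow> 0 \<le> d k"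
  shows "0 \<preceq> (\<Sum>k\<in>I. complex_of_real (d k) *\<^sub>C P k)"
proof -
  have "cinner ((\<Sum>k\<in>I. complex_of_real (d k) *\<^sub>C P k) x) x
      = complex_of_real (\<Sum>k\<in>I. d k * (norm (P k x))\<^sup>2)" for x
    using assms(1)
    by (simp add: blinfun.sum_left cinner_sum_left cinner_scaleC_left cinner_projection)
  moreover have "0 \<le> (\<Sum>k\<in>I. d k * (norm (P k x))\<^sup>2)" for x
    using assms(2) by (intro sum_nonneg) simp
  ultimately show ?thesis by (simp add: operator_le_def less_eq_complex_def)
qed

theorem proposition5p2:
  fixes M :: "('h :: complex_hilbert_space \<Rightarrow>\<^sub>L 'h) set"
    and \<tau> :: "('h \<Rightarrow>\<^sub>L 'h) \<Rightarrow> complex"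
    and N :: "'h \<Rightarrow>\<^sub>L 'h"
    and n :: nat
    and \<mu> w :: "nat \<Rightarrow> complex"
    and \<alpha> :: real
  assumes "tracial_von_neumann_algebra M \<tau>"
    and "N \<in> M"
    and "normal_operator N"
    and "inj_on \<mu> {1..n}"
    and "op_spectrum N = \<mu> ` {1..n}"
    and "\<And>k. k \<in> {1..n} \<Longrightarrow> w k = \<tau> (spectral_projection N {\<mu> k})"
    and "0 < \<alpha>" and "\<alpha> \<le> 1"
  shows "alpha_numerical_range M \<tau> \<alpha> N =
    {complex_of_real (1 / \<alpha>) * (\<Sum>k=1..n. \<mu> k * complex_of_real (t k)) | t :: nat \<Rightarrow> real.
       (\<forall>k\<in>{1..n}. 0 \<le> t k \<and> complex_of_real (t k) \<le> w k) \<and> (\<Sum>k=1..n. t k) = \<alpha>}"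
proof -
  note M = assms(1) and N = assms(3)
  have fin: "finite (op_spectrum N)" by (simp add: assms(5))
  define P where "P k = spectral_part N {\<mu> k}" for k
  have PM: "P k \<in> M" for k
    unfolding P_def spectral_part_def by (rule M_poly_op[OF M assms(2)])
  have Pp: "is_projection (P k)" for k
    unfolding P_def by (rule is_projection_spectral_part[OF N fin])
  have w: "w k = \<tau> (P k)" if "k \<in> {1..n}" for k
    using assms(6)[OF that] spectral_projection_eq_spectral_part[OF N fin, of "\<mu> k"] that
    by (simp add: P_def assms(5))
  have P_sum: "(\<Sum>k=1..n. P k) = id_blinfun"
    using spectral_part_decomposition[OF N fin]
    unfolding P_def assms(5) sum.reindex[OF assms(4)] by simp
  have NP: "N o\<^sub>L P k = \<mu> k *\<^sub>C P k" for k
    unfolding P_def by (rule spectral_part_eigen[OF N fin])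
  show ?thesis (is "_ = ?R")
  proof (intro equalityI subsetI)
    fix z assume "z \<in> alpha_numerical_range M \<tau> \<alpha> N"
    then obtain X where z: "z = complex_of_real (1 / \<alpha>) * \<tau> (N o\<^sub>L X)"
      and X: "X \<in> M" "0 \<preceq> X" "X \<preceq> id_blinfun" and \<tau>X: "\<tau> X = complex_of_real \<alpha>"
      by (auto simp: alpha_numerical_range_def)
    define t where "t k = Re (\<tau> (P k o\<^sub>L X))" for k
    note compress = trace_compression[OF M Pp PM X]
    have t: "complex_of_real (t k) = \<tau> (P k o\<^sub>L X)" for k
      using compress(1)[of k] by (simp add: t_def complex_eq_iff less_eq_complex_def)
    have X_eq: "X = (\<Sum>k=1..n. P k o\<^sub>L X)"
    proof (rule blinfun_eqI)
      show "X x = (\<Sum>k=1..n. P k o\<^sub>L X) x" for x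
        using arg_cong[OF P_sum, of "\<lambda>A. A (X x)"] by (simp add: blinfun.sum_left)
    qed
    have "N o\<^sub>L X = (\<Sum>k=1..n. \<mu> k *\<^sub>C (P k o\<^sub>L X))"
    proof (rule blinfun_eqI)
      fix x
      have "N (X x) = N ((\<Sum>k=1..n. P k) (X x))" unfolding P_sum by simp
      also have "\<dots> = (\<Sum>k=1..n. (N o\<^sub>L P k) (X x))"
        by (simp add: blinfun.sum_left blinfun.sum_right)
      finally show "(N o\<^sub>L X) x = (\<Sum>k=1..n. \<mu> k *\<^sub>C (P k o\<^sub>L X)) x"
        by (simp add: NP blinfun.sum_left)
    qed
    then have "\<tau> (N o\<^sub>L X) = (\<Sum>k=1..n. \<mu> k * complex_of_real (t k))"
      by (simp add: trace_sum[OF M] trace_scaleC[OF M] M_scaleC[OF M] M_compose[OF M] PM X t)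
    moreover have "complex_of_real (\<Sum>k=1..n. t k) = complex_of_real \<alpha>"
      using arg_cong[OF X_eq, of \<tau>] by (simp add: \<tau>X t trace_sum[OF M] M_compose[OF M] PM X)
    then have "(\<Sum>k=1..n. t k) = \<alpha>" by (simp only: of_real_eq_iff)
    moreover have "0 \<le> t k \<and> complex_of_real (t k) \<le> w k" if "k \<in> {1..n}" for k
      using compress[of k] by (simp add: t w[OF that]) (simp add: t_def less_eq_complex_def)
    ultimately show "z \<in> ?R" unfolding z by (intro CollectI exI[of _ t]) simp
  next
    fix z assume "z \<in> ?R"
    then obtain t where z: "z = complex_of_real (1 / \<alpha>) * (\<Sum>k=1..n. \<mu> k * complex_of_real (t k))"
      and t: "\<forall>k\<in>{1..n}. 0 \<le> t k \<and> complex_of_real (t k) \<le> w k"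
      and t\<alpha>: "(\<Sum>k=1..n. t k) = \<alpha>"
      by blast
    have t0: "0 \<le> t k" and tw: "complex_of_real (t k) \<le> \<tau> (P k)" if "k \<in> {1..n}" for k
      using t that by (simp_all flip: w[OF that])
    \<comment> \<open>If \<open>\<tau> (P k) = 0\<close>, then \<open>t k = 0\<close> as well, and the value \<open>c k = 0\<close> of the division is right.\<close>
    define c where "c k = t k / Re (\<tau> (P k))" for k
    have c0: "0 \<le> c k" and c1: "c k \<le> 1" and c: "complex_of_real (c k) * \<tau> (P k) = complex_of_real (t k)"
      if "k \<in> {1..n}" for k
      using t0[OF that] tw[OF that]
      by (auto simp: c_def less_eq_complex_def complex_eq_iff divide_le_eq_1)
    define X where "X = (\<Sum>k=1..n. complex_of_real (c k) *\<^sub>C P k)"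
    have XM: "X \<in> M" unfolding X_def by (intro M_sum[OF M] M_scaleC[OF M] PM)
    have "0 \<preceq> X" unfolding X_def by (intro projection_combination_nonneg Pp c0)
    have "id_blinfun - X = (\<Sum>k=1..n. complex_of_real (1 - c k) *\<^sub>C P k)"
      by (rule blinfun_eqI)
         (simp add: X_def blinfun.diff_left blinfun.sum_left scaleC_diff_left sum_subtractf
           flip: P_sum)
    moreover have "0 \<preceq> (\<Sum>k=1..n. complex_of_real (1 - c k) *\<^sub>C P k)"
      by (intro projection_combination_nonneg Pp) (use c1 in auto)
    ultimately have "X \<preceq> id_blinfun" by (simp add: operator_le_def)
    have "\<tau> X = (\<Sum>k=1..n. complex_of_real (t k))"
      unfolding X_def by (simp add: trace_sum[OF M] trace_scaleC[OF M] M_scaleC[OF M] PM c)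
    then have "\<tau> X = complex_of_real \<alpha>" by (simp flip: t\<alpha>)
    have "N o\<^sub>L X = (\<Sum>k=1..n. (\<mu> k * complex_of_real (c k)) *\<^sub>C P k)"
    proof (rule blinfun_eqI)
      fix x
      have "(N o\<^sub>L X) x = (\<Sum>k=1..n. complex_of_real (c k) *\<^sub>C (N o\<^sub>L P k) x)"
        using assms(3)
        by (simp add: X_def blinfun.sum_left blinfun.sum_right normal_operator_def bounded_operatorsD)
      then show "(N o\<^sub>L X) x = (\<Sum>k=1..n. (\<mu> k * complex_of_real (c k)) *\<^sub>C P k) x"
        by (simp add: NP blinfun.sum_left scaleC_scaleC mult.commute)
    qed
    then have "\<tau> (N o\<^sub>L X) = (\<Sum>k=1..n. \<mu> k * (complex_of_real (c k) * \<tau> (P k)))"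
      by (simp add: trace_sum[OF M] trace_scaleC[OF M] M_scaleC[OF M] PM mult.assoc)
    then have "z = complex_of_real (1 / \<alpha>) * \<tau> (N o\<^sub>L X)" by (simp add: z c)
    then show "z \<in> alpha_numerical_range M \<tau> \<alpha> N"
      using XM \<open>0 \<preceq> X\<close> \<open>X \<preceq> id_blinfun\<close> \<open>\<tau> X = complex_of_real \<alpha>\<close>
      unfolding alpha_numerical_range_def by blast
  qed
qed

end
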